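(* Let the assumptions (T), (S1), (S2), (P1), (P2) spelled out in the context hold and let $\Phi^{n-1}\in\mathbb R^{\dim U_h^\Omega}$ be given. Then a solution $\Phi^n\in\mathbb R^{\dim U_h^\Omega}$, if it exists, of $$\Phi^n+\tau m\,\mathbf M_\Omega^{-1}\mathbf L_\Omega P^n=\Phi^{n-1},$$ with $P^n$ and $P^n_\Gamma$ the vectors defined from $\Phi^n,\Phi^{n-1}$ in the context, satisfies $$\begin{aligned} &\tfrac12(\Phi^n)^T\mathbf L_\Omega\Phi^n+\tfrac12(\Phi^n-\Phi^{n-1})^T\mathbf L_\Omega(\Phi^n-\Phi^{n-1})+\mathbf 1^T\mathbf M_\Omega F(\Phi^n)\\ &+\tfrac12\kappa(\Phi^n|_\Gamma)^T\mathbf L_\Gamma\Phi^n|_\Gamma+\tfrac12\kappa\big((\Phi^n-\Phi^{n-1})|_\Gamma\big)^T\mathbf L_\Gamma(\Phi^n-\Phi^{n-1})|_\Gamma+\mathbf 1_\Gamma^T\mathbf M_\Gamma G(\Phi^n|_\Gamma)\\ &+\beta\big((\Phi^n-\Phi^{n-1})|_\Gamma\big)^T\mathbf M_\Gamma(\Phi^n-\Phi^{n-1})|_\Gamma+\tau m(P^n)^T\mathbf L_\Omega P^n+\tau m_\Gamma(P^n_\Gamma)^T\mathbf L_\Gamma P^n_\Gamma\\ &\le\tfrac12(\Phi^{n-1})^T\mathbf L_\Omega\Phi^{n-1}+\mathbf 1^T\mathbf M_\Omega F(\Phi^{n-1})+\tfrac12\kappa(\Phi^{n-1}|_\Gamma)^T\mathbf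 L_\Gamma\Phi^{n-1}|_\Gamma+\mathbf 1_\Gamma^T\mathbf M_\Gamma G(\Phi^{n-1}|_\Gamma), \end{aligned}$$ with $\mathbf 1=(1,\dots,1)^T\in\mathbb R^{\dim U_h^\Omega}$ and $\mathbf 1_\Gamma=\mathbf 1|_\Gamma$.
   Context: $\Omega\subset\mathbb R^d$, $d\in\{2,3\}$, is a bounded convex polygonal (polyhedral) domain with boundary $\Gamma$; $\nabla_\Gamma$ is the surface gradient on $\Gamma$; $m,m_\Gamma>0$, $\kappa\ge0$ are constants (and $\sigma=\delta=\delta_\Gamma=1$). (T) The time interval $[0,T)$ is divided into $N$ subintervals of equal length $\tau=T/N>0$. (S1) $\{\mathcal T_h\}_{h>0}$ is a quasiuniform family of (conforming) partitions of $\Omega$ into disjoint open simplices $K$ with $\overline\Omega=\bigcup_{K\in\mathcal T_h}\overline K$ and $\max_K\operatorname{diam}(K)\le h$. (S2) $\{\mathcal T_h^\Gamma\}_{h>0}$ is a quasiuniform family of partitions of $\Gamma$ into disjoint open simplices $K^\Gamma$ such that for every $K^\Gamma\in\mathcal T_h^\Gamma$ there is exactly one $K\in\mathcal T_h$ with $\overline{K^\Gamma}=\overline K\cap\Gamma$, and $\Gamma=\bigcup\overline{K^\Gamma}$, $\max\operatorname{diam}(K^\Gamma)\le h$. (P1) $F,G\in C^1(\mathbb R)$ are bounded from below; there are convex, non-negative $F_+,G_+\in C^1(\mathbb R)$ and concave $F_-,G_-\in C^1(\mathbb R)$ with $F=F_++F_-$, $G=G_++G_-$. (P2) The convex and concave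 parts of $F$ and $G$ can be further decomposed into a polynomial part of degree (at most) four and a part with globally Lipschitz-continuous first derivative. Moreover there is $\beta\ge0$ such that $G_-'(s_2)(s_1-s_2)\ge G_-(s_1)-G_-(s_2)+\beta|s_1-s_2|^2$ for all $s_1,s_2\in\mathbb R$; if $\kappa=0$ this is assumed with some $\beta>0$. $U_h^\Omega$ and $U_h^\Gamma$ are the spaces of continuous, piecewise linear finite element functions on $\mathcal T_h$ and $\mathcal T_h^\Gamma$, with nodal bases $\{\chi_{h,k}\}$ and $\{\chi^\Gamma_{h,k}\}$ dual to the vertices; the first $\dim U_h^\Gamma$ vertices of $\mathcal T_h$ are those on $\Gamma$, in the same order as the vertices of $\mathcal T_h^\Gamma$. $\mathcal I_h$, $\mathcal I_h^\Gamma$ are the nodal interpolation operators. Matrices: $(\mathbf M_\Omega)_{ij}=\int_\Omega\mathcal I_h\{\chi_{h,j}\chi_{h,i}\}$, $(\mathbf M_\Gamma)_{ij}=\int_\Gamma\mathcal I_h^\Gamma\{\chi^\Gamma_{h,j}\chi^\Gamma_{h,i}\}$ (both diagonal with positive entries), $(\mathbf L_\Omega)_{ij}=\int_\Omega\nabla\chi_{h,j}\cdot\nabla\chi_{h,i}$, $(\mathbf L_\Gamma)_{ij}=\int_\Gamma\nabla_\Gamma\chi^\Gamma_{h,j}\cdot\nabla_\Gamma\chi^\Gamma_{h,i}$. For a matrix $\mathbf A$ of size $\dim U_h^\Omega$, subscripts denote blocks: $\Gamma$ = the first $\dim U_h^\Gamma$ indices, $\circ$ = the remaining (interior) indices, $\Omega$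 = all indices (first subscript rows, second columns). For a vector $A$, $A|_\Gamma$ and $A|_\circ$ are the corresponding subvectors; scalar functions are applied to vectors componentwise. Define $$R_\Gamma(\Phi^n)=(\mathbf L_\Omega)_{\Gamma\Omega}\Phi^n+(\mathbf M_\Omega)_{\Gamma\Omega}\big(F_+'(\Phi^n)+F_-'(\Phi^{n-1})\big)+\kappa\mathbf L_\Gamma\Phi^n|_\Gamma+\mathbf M_\Gamma\big(G_+'(\Phi^n|_\Gamma)+G_-'(\Phi^{n-1}|_\Gamma)\big),$$ $$R_\circ(\Phi^n)=(\mathbf L_\Omega)_{\circ\Omega}\Phi^n+(\mathbf M_\Omega)_{\circ\Omega}\big(F_+'(\Phi^n)+F_-'(\Phi^{n-1})\big),$$ $$\mathbf S=m(\mathbf L_\Omega)_{\Gamma\Gamma}+m_\Gamma(\mathbf M_\Omega)_{\Gamma\Gamma}\mathbf M_\Gamma^{-1}\mathbf L_\Gamma\mathbf M_\Gamma^{-1}(\mathbf M_\Omega)_{\Gamma\Gamma}$$ ($\mathbf S$ is symmetric positive definite). The vectors $P^n\in\mathbb R^{\dim U_h^\Omega}$, $P^n_\Gamma\in\mathbb R^{\dim U_h^\Gamma}$ are defined by $$P^n|_\circ=(\mathbf M_\Omega)_{\circ\circ}^{-1}R_\circ(\Phi^n),$$ $$P^n|_\Gamma=\mathbf S^{-1}\Big(-m(\mathbf L_\Omega)_{\Gamma\circ}(\mathbf M_\Omega)_{\circ\circ}^{-1}R_\circ(\Phi^n)+m_\Gamma(\mathbf M_\Omega)_{\Gamma\Gamma}\mathbf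 M_\Gamma^{-1}\mathbf L_\Gamma\mathbf M_\Gamma^{-1}R_\Gamma(\Phi^n)\Big),$$ $$P_\Gamma^n=-\mathbf M_\Gamma^{-1}(\mathbf M_\Omega)_{\Gamma\Gamma}P^n|_\Gamma+\mathbf M_\Gamma^{-1}R_\Gamma(\Phi^n).$$ *)

theory Defs
  imports
    "HOL-Analysis.Analysis"
    "Jordan_Normal_Form.Gauss_Jordan_Elimination"
    "Jordan_Normal_Form.DL_Submatrix"
begin

text \<open>
  Vectors and matrices are those of \<^theory>\<open>Jordan_Normal_Form.Matrix\<close>, since the dimensions depend
  on the mesh (and the block of interior indices could a priori be empty).
\<close>

hide_type (open) Finite_Cartesian_Product.vec
hide_const (open) Finite_Cartesian_Product.vec Finite_Cartesian_Product.mat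
no_notation vec_nth (infixl \<open>$\<close> 90)
no_notation vec_lambda (binder \<open>\<chi>\<close> 10)
no_notation inner (infix \<open>\<bullet>\<close> 70)

text \<open>Meaningful for invertible matrices only; \<^const>\<open>mat_inverse\<close> returns \<open>None\<close> otherwise.\<close>
abbreviation minv :: "real mat \<Rightarrow> real mat" where
  "minv A \<equiv> the (mat_inverse A)"

subsection \<open>Domain and meshes\<close>

definition convex_polyhedral_domain :: "'a::euclidean_space set \<Rightarrow> bool" where
  "convex_polyhedral_domain \<Omega> \<longleftrightarrow>
     open \<Omega> \<and> \<Omega> \<noteq> {} \<and> convex \<Omega> \<and> bounded \<Omega> \<and> polyhedron (closure \<Omega>)"

definition open_simplex :: "int \<Rightarrow> 'a::euclidean_space set \<Rightarrow> bool" where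
  "open_simplex k K \<longleftrightarrow> (\<exists>S. k simplex S \<and> K = rel_interior S)"

definition simplicial_partition :: "int \<Rightarrow> 'a::euclidean_space set \<Rightarrow> 'a set set \<Rightarrow> bool" where
  "simplicial_partition k S \<T> \<longleftrightarrow>
     finite \<T> \<and> (\<forall>K\<in>\<T>. open_simplex k K) \<and> disjoint \<T> \<and> S = (\<Union>K\<in>\<T>. closure K)"

text \<open>
  Quasiuniformity: the inradius of every element (inside its affine hull) is bounded below by a fixed
  multiple of the actual mesh size. The actual mesh size is used instead of \<open>h\<close>, which is only
  an upper bound for it: as \<open>h\<close> ranges over all positive reals, a lower bound proportional to \<open>h\<close>
  could not be satisfied on a bounded domain.
\<close>
definition quasiuniform :: "(real \<Rightarrow> 'a::euclidean_space set set) \<Rightarrow> bool" where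
  "quasiuniform \<T> \<longleftrightarrow>
     (\<exists>\<rho>>0. \<forall>h>0. \<forall>K\<in>\<T> h. \<exists>z\<in>K.
        ball z (\<rho> * Max (diameter ` \<T> h)) \<inter> affine hull K \<subseteq> K)"

text \<open>Conformity is expressed by \<^const>\<open>triangulation\<close>: closed elements meet in common faces.\<close>
definition bulk_mesh_family :: "'a::euclidean_space set \<Rightarrow> (real \<Rightarrow> 'a set set) \<Rightarrow> bool" where
  "bulk_mesh_family \<Omega> \<T> \<longleftrightarrow>
     quasiuniform \<T> \<and>
     (\<forall>h>0. simplicial_partition (int DIM('a)) (closure \<Omega>) (\<T> h) \<and>
            triangulation (closure ` \<T> h) \<and>
            (\<forall>K\<in>\<T> h. diameter K \<le> h))"

definition surface_mesh_family ::
    "'a::euclidean_space set \<Rightarrow> (real \<Rightarrow> 'a set set) \<Rightarrow> (real \<Rightarrow> 'a set set) \<Rightarrow> bool" where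
  "surface_mesh_family \<Omega> \<T> \<T>\<^sub>\<Gamma> \<longleftrightarrow>
     quasiuniform \<T>\<^sub>\<Gamma> \<and>
     (\<forall>h>0. simplicial_partition (int DIM('a) - 1) (frontier \<Omega>) (\<T>\<^sub>\<Gamma> h) \<and>
            (\<forall>K'\<in>\<T>\<^sub>\<Gamma> h. \<exists>!K. K \<in> \<T> h \<and> closure K' = closure K \<inter> frontier \<Omega>) \<and>
            (\<forall>K'\<in>\<T>\<^sub>\<Gamma> h. diameter K' \<le> h))"

definition mesh_vertices :: "'a::euclidean_space set set \<Rightarrow> 'a set" where
  "mesh_vertices \<T> = (\<Union>K\<in>\<T>. {v. v extreme_point_of closure K})"

subsection \<open>Finite element spaces\<close>

text \<open>Functions are total on \<open>'a\<close>; only their values on \<open>S\<close> are relevant.\<close>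
definition p1_space :: "'a::euclidean_space set \<Rightarrow> 'a set set \<Rightarrow> ('a \<Rightarrow> real) set" where
  "p1_space S \<T> = {v. continuous_on S v \<and> (\<forall>K\<in>\<T>. \<exists>a b. \<forall>y\<in>K. v y = a + inner b y)}"

text \<open>
  The basis dual to the vertices \<open>x 0, \<dots>, x (N - 1)\<close>; duality determines every basis function
  uniquely on \<open>S\<close>, and \<open>N\<close> is the dimension of the space.
\<close>
definition nodal_basis ::
    "'a::euclidean_space set \<Rightarrow> 'a set set \<Rightarrow> nat \<Rightarrow> (nat \<Rightarrow> 'a) \<Rightarrow> (nat \<Rightarrow> 'a \<Rightarrow> real) \<Rightarrow> bool" where
  "nodal_basis S \<T> N x \<chi> \<longleftrightarrow>
     (\<forall>k<N. \<chi> k \<in> p1_space S \<T> \<and> (\<forall>j<N. \<chi> k (x j) = (if j = k then 1 else 0)))"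

definition nodal_interpolation ::
    "nat \<Rightarrow> (nat \<Rightarrow> 'a) \<Rightarrow> (nat \<Rightarrow> 'a \<Rightarrow> real) \<Rightarrow> ('a \<Rightarrow> real) \<Rightarrow> 'a \<Rightarrow> real" where
  "nodal_interpolation N x \<chi> f = (\<lambda>y. \<Sum>k<N. f (x k) * \<chi> k y)"

subsection \<open>Gradients and surface integrals\<close>

text \<open>
  Where a function is not differentiable, \<open>THE\<close> yields a fixed vector. For finite element functions
  this concerns only the null set of element boundaries.
\<close>
definition grad :: "('a::euclidean_space \<Rightarrow> real) \<Rightarrow> 'a \<Rightarrow> 'a" where
  "grad f y = (THE D. GDERIV f y :> D)"

text \<open>
  The surface of a polyhedron is flat away from the null set of its edges: at a point \<open>y\<close> in the
  relative interior of a facet \<open>F\<close>, the tangent space is the direction space of \<open>F\<close>, and the surface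
  gradient is the tangent vector representing the derivative of \<open>f\<close> along \<open>F\<close>.
\<close>
definition surface_grad :: "'a::euclidean_space set \<Rightarrow> ('a \<Rightarrow> real) \<Rightarrow> 'a \<Rightarrow> 'a" where
  "surface_grad \<Omega> f y =
     (THE D. \<exists>F. F facet_of closure \<Omega> \<and> y \<in> rel_interior F \<and>
                 D \<in> span ((\<lambda>z. z - y) ` F) \<and>
                 (f has_derivative (\<lambda>v. inner D v)) (at y within F))"

definition unit_normal :: "'a::euclidean_space set \<Rightarrow> 'a" where
  "unit_normal F = (SOME n. norm n = 1 \<and> (\<forall>y\<in>F. \<forall>z\<in>F. inner n (y - z) = 0))"

text \<open>
  The integral over a flat hypersurface piece \<open>F\<close> with respect to its surface measure. By Fubini it
  equals the Lebesgue integral over the right prism of height 1 with base \<open>F\<close> of the function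
  extended constantly in normal direction; \<open>closest_point (affine hull F)\<close> maps \<open>y + t *\<^sub>R n\<close>
  back to \<open>y\<close>.
\<close>
definition flat_integral :: "'a::euclidean_space set \<Rightarrow> ('a \<Rightarrow> real) \<Rightarrow> real" where
  "flat_integral F f =
     (LINT z:{y + t *\<^sub>R unit_normal F | y t. y \<in> F \<and> t \<in> {0..1}}|lebesgue.
        f (closest_point (affine hull F) z))"

text \<open>Distinct facets meet in surface null sets.\<close>
definition surface_integral :: "'a::euclidean_space set \<Rightarrow> ('a \<Rightarrow> real) \<Rightarrow> real" where
  "surface_integral \<Omega> f = (\<Sum>F | F facet_of closure \<Omega>. flat_integral F f)"

subsection \<open>Mass and stiffness matrices\<close>

definition bulk_mass :: "'a::euclidean_space set \<Rightarrow> nat \<Rightarrow> (nat \<Rightarrow> 'a) \<Rightarrow> (nat \<Rightarrow> 'a \<Rightarrow> real) \<Rightarrow> real mat" where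
  "bulk_mass \<Omega> N x \<chi> = mat N N (\<lambda>(i, j).
     LINT y:\<Omega>|lebesgue. nodal_interpolation N x \<chi> (\<lambda>z. \<chi> j z * \<chi> i z) y)"

definition bulk_stiffness :: "'a::euclidean_space set \<Rightarrow> nat \<Rightarrow> (nat \<Rightarrow> 'a \<Rightarrow> real) \<Rightarrow> real mat" where
  "bulk_stiffness \<Omega> N \<chi> = mat N N (\<lambda>(i, j).
     LINT y:\<Omega>|lebesgue. inner (grad (\<chi> j) y) (grad (\<chi> i) y))"

definition surface_mass :: "'a::euclidean_space set \<Rightarrow> nat \<Rightarrow> (nat \<Rightarrow> 'a) \<Rightarrow> (nat \<Rightarrow> 'a \<Rightarrow> real) \<Rightarrow> real mat" where
  "surface_mass \<Omega> N x \<chi> = mat N N (\<lambda>(i, j).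
     surface_integral \<Omega> (nodal_interpolation N x \<chi> (\<lambda>z. \<chi> j z * \<chi> i z)))"

definition surface_stiffness :: "'a::euclidean_space set \<Rightarrow> nat \<Rightarrow> (nat \<Rightarrow> 'a \<Rightarrow> real) \<Rightarrow> real mat" where
  "surface_stiffness \<Omega> N \<chi> = mat N N (\<lambda>(i, j).
     surface_integral \<Omega> (\<lambda>y. inner (surface_grad \<Omega> (\<chi> j) y) (surface_grad \<Omega> (\<chi> i) y)))"

subsection \<open>Potentials\<close>

definition convex_concave_splitting :: "(real \<Rightarrow> real) \<Rightarrow> (real \<Rightarrow> real) \<Rightarrow> (real \<Rightarrow> real) \<Rightarrow> bool" where
  "convex_concave_splitting F Fp Fm \<longleftrightarrow>
     F C1_differentiable_on UNIV \<and> bdd_below (range F) \<and>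
     Fp C1_differentiable_on UNIV \<and> convex_on UNIV Fp \<and> (\<forall>s. 0 \<le> Fp s) \<and>
     Fm C1_differentiable_on UNIV \<and> concave_on UNIV Fm \<and>
     (\<forall>s. F s = Fp s + Fm s)"

definition quartic_plus_lipschitz :: "(real \<Rightarrow> real) \<Rightarrow> bool" where
  "quartic_plus_lipschitz f \<longleftrightarrow>
     (\<exists>(p :: real poly) q L. degree p \<le> 4 \<and>
        q C1_differentiable_on UNIV \<and> L-lipschitz_on UNIV (deriv q) \<and>
        (\<forall>s. f s = poly p s + q s))"

end

theory Submission
  imports Defs "Jordan_Normal_Form.Determinant"
begin

text \<open>
  The definition of \<open>P|\<^sub>\<Gamma>\<close> through \<open>S\<close> says exactly that
  \<open>m (L\<^sub>\<Omega> P)|\<^sub>\<Gamma> = m\<^sub>\<Gamma> (M\<^sub>\<Omega>)\<^sub>\<Gamma>\<^sub>\<Gamma> M\<^sub>\<Gamma>\<inverse> L\<^sub>\<Gamma> P\<^sub>\<Gamma>\<close>, so the scheme also yields the surface equation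
  \<open>M\<^sub>\<Gamma> (\<Phi> - \<Phi>\<^sub>o\<^sub>l\<^sub>d)|\<^sub>\<Gamma> = - \<tau> m\<^sub>\<Gamma> L\<^sub>\<Gamma> P\<^sub>\<Gamma>\<close>. Testing the bulk equation with \<open>P\<close> and the surface equation
  with \<open>P\<^sub>\<Gamma>\<close> turns both dissipation terms into the pairing of \<open>\<Phi> - \<Phi>\<^sub>o\<^sub>l\<^sub>d\<close> with the residuals \<open>R\<close>, which
  is estimated by the tangent inequalities for the convex and concave parts and by
  \<open>2 (u - v) \<cdot> L u = u \<cdot> L u - v \<cdot> L v + (u - v) \<cdot> L (u - v)\<close>. This needs that the lumped mass
  matrices are diagonal with positive entries and that \<open>S\<close> is invertible. The latter holds because
  \<open>L\<^sub>\<Gamma>\<close> is positive semidefinite and \<open>L\<^sub>\<Omega>\<close> is positive definite on vectors supported on boundary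
  vertices.
\<close>

section \<open>Integrals of continuous and of piecewise constant functions\<close>

lemma set_integrable_continuous:
  fixes f :: "'a::euclidean_space \<Rightarrow> real"
  assumes "bounded Q" "Q \<in> sets lebesgue" "continuous_on (closure Q) f"
  shows "set_integrable lebesgue Q f"
proof -
  have "integrable lborel (\<lambda>x. indicator (closure Q) x *\<^sub>R f x)"
    using assms by (intro borel_integrable_compact) auto
  then have "set_integrable lebesgue (closure Q) f"
    unfolding set_integrable_def using integrable_completion borel_measurable_integrable by blast
  then show ?thesis
    by (rule set_integrable_subset) (use assms closure_subset in auto)
qed

text \<open>By continuity \<open>f\<close> stays above \<open>f p / 2\<close> on a ball around
  \<open>p\<close>, and this ball meets \<open>interior Q\<close> in a nonempty open set, which has
  positive measure. The point \<open>p\<close> may lie on the boundary of \<open>Q\<close>, as some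
  mesh vertices do.\<close>

lemma set_integral_pos:
  fixes f :: "'a::euclidean_space \<Rightarrow> real"
  assumes Q: "bounded Q" "Q \<in> sets lebesgue" and f: "continuous_on (closure Q) f"
    and nn: "\<And>y. y \<in> Q \<Longrightarrow> 0 \<le> f y"
    and p: "p \<in> closure (interior Q)" "0 < f p"
  shows "0 < (LINT y:Q|lebesgue. f y)"
proof -
  have pQ: "p \<in> closure Q"
    using p(1) closure_mono[OF interior_subset] by blast
  obtain d where d: "d > 0" "\<And>y. y \<in> closure Q \<Longrightarrow> dist y p < d \<Longrightarrow> dist (f y) (f p) < f p / 2"
    using f pQ p(2) unfolding continuous_on_iff by (metis half_gt_zero)
  define U where "U = interior Q \<inter> ball p d"
  have "\<exists>y\<in>interior Q. dist y p < d"
    using p(1) d(1) closure_approachable by blast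
  then have U: "open U" "U \<noteq> {}" "bounded U" "U \<subseteq> Q"
    unfolding U_def using Q(1) interior_subset bounded_subset by (auto simp: dist_commute)
  have Um: "U \<in> lmeasurable"
    using U(1,3) by (intro bounded_set_imp_lmeasurable) auto
  have "measure lebesgue U \<noteq> 0"
    using U(1,2) Um open_not_negligible negligible_iff_measure by blast
  then have mU: "0 < measure lebesgue U"
    using measure_nonneg[of lebesgue U] by linarith
  have lower: "f p / 2 \<le> f y" if "y \<in> U" for y
  proof -
    have "dist (f y) (f p) < f p / 2"
      using that subsetD[OF U(4) that] subsetD[OF closure_subset, of y Q]
      by (intro d(2)) (auto simp: U_def dist_commute)
    then show ?thesis by (simp add: dist_real_def abs_if split: if_splits)
  qed
  have "0 < f p / 2 * measure lebesgue U"
    using mU p(2) by simp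
  also have "\<dots> = (LINT y|lebesgue. f p / 2 * indicator U y)"
    using Um by simp
  also have "\<dots> \<le> (LINT y|lebesgue. indicator Q y *\<^sub>R f y)"
  proof (rule integral_mono)
    show "integrable lebesgue (\<lambda>y. f p / 2 * indicator U y)"
      using Um by (intro integrable_mult_right integrable_real_indicator) (auto simp: fmeasurable_def)
    show "integrable lebesgue (\<lambda>y. indicator Q y *\<^sub>R f y)"
      using set_integrable_continuous[OF Q f] by (simp add: set_integrable_def)
    show "f p / 2 * indicator U y \<le> indicator Q y *\<^sub>R f y" for y
      using lower[of y] nn[of y] U(4) by (auto simp: indicator_def)
  qed
  finally show ?thesis
    by (simp add: set_lebesgue_integral_def)
qed

text \<open>Up to a null set \<open>f\<close> is the step function \<open>g\<close>. Meant for
  products of finite element gradients, which are constant on each element and uncontrolled on the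
  skeleton of the mesh.\<close>

lemma set_integral_piecewise_const:
  fixes f :: "'a::euclidean_space \<Rightarrow> real"
  assumes I: "finite I" "disjoint_family_on C I"
    and C: "\<And>i. i \<in> I \<Longrightarrow> C i \<in> lmeasurable" "\<And>i. i \<in> I \<Longrightarrow> C i \<subseteq> Q"
    and null: "negligible (Q - (\<Union>i\<in>I. C i))"
    and f: "\<And>i y. i \<in> I \<Longrightarrow> y \<in> C i \<Longrightarrow> f y = c i"
  shows "(LINT y:Q|lebesgue. f y) = (\<Sum>i\<in>I. c i * measure lebesgue (C i))"
proof -
  define g where "g y = (\<Sum>i\<in>I. c i * indicator (C i) y)" for y
  have gQ: "indicator Q y *\<^sub>R g y = g y" for y
    unfolding g_def scaleR_sum_right using C(2) by (intro sum.cong) (auto simp: indicator_def)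
  have int: "integrable lebesgue (\<lambda>y. c i * indicator (C i) y)" if "i \<in> I" for i
    using C(1)[OF that] by (intro integrable_mult_right integrable_real_indicator) (auto simp: fmeasurable_def)
  have g: "set_integrable lebesgue Q g"
    unfolding set_integrable_def gQ unfolding g_def using int by (intro Bochner_Integration.integrable_sum)
  have fg: "f y = g y" if y: "y \<in> Q - (Q - (\<Union>i\<in>I. C i))" for y
  proof -
    obtain i where i: "i \<in> I" "y \<in> C i" using y by auto
    have "g y = (\<Sum>j\<in>I. if j = i then c i else 0)"
      unfolding g_def using i I(2)
      by (intro sum.cong) (auto simp: indicator_def disjoint_family_on_def)
    then show ?thesis using i I(1) f by simp
  qed
  \<comment> \<open>The detour through the gauge integral allows \<open>f\<close> to be replaced by
    \<open>g\<close> off a null set; integrability of \<open>f\<close> itself is inherited from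
    \<open>g\<close> in the same way.\<close>
  have "(LINT y:Q|lebesgue. f y) = integral Q f"
    by (rule set_lebesgue_integral_eq_integral(2)[OF absolutely_integrable_spike[OF g null fg]])
  also have "\<dots> = integral Q g"
    by (rule integral_spike[OF null]) (use fg in auto)
  also have "\<dots> = (LINT y:Q|lebesgue. g y)"
    by (rule set_lebesgue_integral_eq_integral(2)[OF g, symmetric])
  also have "\<dots> = (LINT y|lebesgue. g y)"
    by (simp only: set_lebesgue_integral_def gQ)
  also have "\<dots> = (\<Sum>i\<in>I. c i * measure lebesgue (C i))"
    unfolding g_def using int C(1) by (subst Bochner_Integration.integral_sum) auto
  finally show ?thesis .
qed

section \<open>Piecewise linear functions\<close>

text \<open>\<open>K\<close> is the relative interior of a closed simplex \<open>S\<close>, and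
  \<open>closure K\<close> recovers \<open>S\<close>; all facts are read off
  \<open>S\<close>.\<close>

lemma open_simplexD:
  fixes K :: "'a::euclidean_space set"
  assumes "open_simplex k K"
  shows "convex K" "bounded K" "convex (closure K)" "compact (closure K)" "polyhedron (closure K)"
    "aff_dim K = k" "aff_dim (closure K) = k" "rel_interior K = K" "rel_interior (closure K) = K"
proof -
  obtain S where S: "k simplex S" "K = rel_interior S"
    using assms by (auto simp: open_simplex_def)
  have cl: "closure K = S"
    using S convex_closure_rel_interior[OF convex_simplex[OF S(1)]] closed_simplex[OF S(1)] by simp
  show "convex K" "bounded K" "convex (closure K)" "compact (closure K)" "polyhedron (closure K)"
    "aff_dim K = k" "aff_dim (closure K) = k" "rel_interior (closure K) = K"
    using convex_simplex[OF S(1)] compact_simplex[OF S(1)] simplex_imp_polyhedron[OF S(1)]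
      aff_dim_simplex[OF S(1)] bounded_subset[OF compact_imp_bounded[OF compact_simplex[OF S(1)]] rel_interior_subset] S(2)
    unfolding cl by (auto simp: convex_rel_interior rel_interior_aff_dim)
  then show "rel_interior K = K"
    using convex_rel_interior_closure by metis
qed

text \<open>In full dimension the affine hull is the whole space, so relative interior and interior
  agree.\<close>

lemma open_simplex_full_open:
  fixes K :: "'a::euclidean_space set"
  assumes "open_simplex (int DIM('a)) K"
  shows "open K"
proof -
  have "affine hull K = UNIV"
    using open_simplexD(6)[OF assms] aff_dim_eq_full by auto
  then show ?thesis
    using open_simplexD(8)[OF assms] rel_interior_interior[of K] interior_open open_interior by metis
qed

text \<open>The difference of \<open>v\<close> and its affine expression is continuous on
  \<open>closure K\<close> and vanishes on \<open>K\<close>. Passing to the closure makes the values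
  at the vertices available.\<close>

lemma p1_space_affine_on_closure:
  assumes "v \<in> p1_space S \<T>" "K \<in> \<T>" "closure K \<subseteq> S"
  obtains a b where "\<And>y. y \<in> closure K \<Longrightarrow> v y = a + inner b y"
proof -
  obtain a b where ab: "\<And>y. y \<in> K \<Longrightarrow> v y = a + inner b y"
    using assms by (auto simp: p1_space_def)
  have "continuous_on (closure K) (\<lambda>y. v y - (a + inner b y))"
    using assms continuous_on_subset by (intro continuous_intros) (auto simp: p1_space_def)
  then have "v y - (a + inner b y) = 0" if "y \<in> closure K" for y
    by (rule continuous_constant_on_closure) (use ab that in auto)
  then show ?thesis
    using that[of a b] by simp
qed

text \<open>On \<open>closure K\<close> the basis function is affine with value 0 or 1 at each
  vertex, and by Krein-Milman \<open>closure K\<close> is the convex hull of its vertices.\<close>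

lemma nodal_basis_nonneg:
  fixes S :: "'a::euclidean_space set"
  assumes basis: "nodal_basis S \<T> N x \<chi>" and part: "simplicial_partition k S \<T>"
    and vert: "mesh_vertices \<T> \<subseteq> x ` {..<N}" and i: "i < N" and y: "y \<in> S"
  shows "0 \<le> \<chi> i y"
proof -
  obtain K where K: "K \<in> \<T>" "y \<in> closure K" "closure K \<subseteq> S" "open_simplex k K"
    using part y by (auto simp: simplicial_partition_def)
  obtain a b where ab: "\<And>y. y \<in> closure K \<Longrightarrow> \<chi> i y = a + inner b y"
    using basis i p1_space_affine_on_closure[OF _ K(1,3)] by (metis nodal_basis_def)
  have "{v. v extreme_point_of closure K} \<subseteq> {z. inner b z \<ge> - a}"
  proof
    fix v assume v: "v \<in> {v. v extreme_point_of closure K}"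
    then have "v \<in> x ` {..<N}" using vert K(1) by (auto simp: mesh_vertices_def)
    then have "0 \<le> \<chi> i v" using basis i by (auto simp: nodal_basis_def)
    moreover have "v \<in> closure K" using v by (auto simp: extreme_point_of_def)
    ultimately show "v \<in> {z. inner b z \<ge> - a}" using ab by auto
  qed
  then have "convex hull {v. v extreme_point_of closure K} \<subseteq> {z. inner b z \<ge> - a}"
    by (intro hull_minimal) (auto simp: convex_halfspace_ge)
  then have "closure K \<subseteq> {z. inner b z \<ge> - a}"
    using Krein_Milman_Minkowski open_simplexD(3,4)[OF K(4)] by metis
  then show ?thesis using ab[OF K(2)] K(2) by auto
qed

text \<open>At a vertex the product is 1 only if both indices are that of the vertex. This is mass
  lumping, the reason why the mass matrices are diagonal.\<close>

lemma nodal_interpolation_basis_product: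
  assumes "nodal_basis S \<T> N x \<chi>" "i < N" "j < N"
  shows "nodal_interpolation N x \<chi> (\<lambda>z. \<chi> j z * \<chi> i z) = (\<lambda>y. if i = j then \<chi> i y else 0)"
proof
  fix y
  have "nodal_interpolation N x \<chi> (\<lambda>z. \<chi> j z * \<chi> i z) y
      = (\<Sum>k<N. if k = i then (if i = j then \<chi> i y else 0) else 0)"
    unfolding nodal_interpolation_def using assms
    by (intro sum.cong) (auto simp: nodal_basis_def)
  then show "nodal_interpolation N x \<chi> (\<lambda>z. \<chi> j z * \<chi> i z) y = (if i = j then \<chi> i y else 0)"
    using assms(2) by simp
qed

lemma grad_affine:
  fixes f :: "'a::euclidean_space \<Rightarrow> real"
  assumes "open K" "y \<in> K" "\<And>z. z \<in> K \<Longrightarrow> f z = a + inner b z"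
  shows "grad f y = b"
proof -
  have d: "GDERIV f y :> b"
  proof -
    have "((\<lambda>z. a + inner b z) has_derivative (\<lambda>h. inner h b)) (at y)"
      by (auto intro!: derivative_eq_intros simp: inner_commute)
    then show ?thesis
      unfolding gderiv_def
      by (rule has_derivative_transform_within_open[OF _ assms(1,2)]) (use assms(3) in auto)
  qed
  moreover have "D = b" if "GDERIV f y :> D" for D
  proof -
    have "(\<lambda>h. inner h D) = (\<lambda>h. inner h b)"
      using that d unfolding gderiv_def by (rule has_derivative_unique)
    then have "inner (D - b) D = inner (D - b) b" by metis
    then have "inner (D - b) (D - b) = 0" by (simp add: inner_diff_right)
    then show ?thesis by simp
  qed
  ultimately show ?thesis
    unfolding grad_def by blast
qed

section \<open>Surface integrals and surface gradients\<close>

text \<open>Written as the image of a product under a linear map, so that convexity and compactness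
  carry over from \<open>A\<close>.\<close>

definition prism :: "'a::euclidean_space \<Rightarrow> 'a set \<Rightarrow> 'a set" where
  "prism n A = (\<lambda>(y, t). y + t *\<^sub>R n) ` (A \<times> {0..1})"

lemma flat_integral_prism:
  "flat_integral F f = (LINT z:prism (unit_normal F) F|lebesgue. f (closest_point (affine hull F) z))"
proof -
  have "{y + t *\<^sub>R unit_normal F | y t. y \<in> F \<and> t \<in> {0..1}} = prism (unit_normal F) F"
    by (force simp: prism_def)
  then show ?thesis by (simp add: flat_integral_def)
qed

lemma prismI: "y \<in> A \<Longrightarrow> t \<in> {0..1} \<Longrightarrow> y + t *\<^sub>R n \<in> prism n A"
  by (force simp: prism_def)

lemma prismE:
  assumes "z \<in> prism n A"
  obtains y t where "y \<in> A" "t \<in> {0..1}" "z = y + t *\<^sub>R n"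
  using assms by (auto simp: prism_def)

lemma prism_mono: "A \<subseteq> B \<Longrightarrow> prism n A \<subseteq> prism n B"
  unfolding prism_def by (intro image_mono) auto

lemma convex_prism: "convex A \<Longrightarrow> convex (prism n A)"
proof -
  assume "convex A"
  have "linear (\<lambda>(y, t::real). y + t *\<^sub>R n)"
    by (rule linearI) (auto simp: algebra_simps)
  then show ?thesis
    unfolding prism_def using \<open>convex A\<close> by (intro convex_linear_image convex_Times) auto
qed

lemma compact_prism: "compact A \<Longrightarrow> compact (prism n A)"
  unfolding prism_def
  by (intro compact_continuous_image compact_Times) (auto simp: case_prod_beta intro!: continuous_intros)

lemma lmeasurable_prism:
  assumes "convex A" "bounded A"
  shows "prism n A \<in> lmeasurable"
proof (rule measurable_convex[OF convex_prism[OF assms(1)]])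
  have "bounded (prism n (closure A))"
    using assms by (intro compact_imp_bounded compact_prism) auto
  moreover have "prism n A \<subseteq> prism n (closure A)"
    by (rule prism_mono[OF closure_subset])
  ultimately show "bounded (prism n A)" by (rule bounded_subset)
qed

text \<open>The direction \<open>n\<close> raises the affine dimension by at most one, so the prism
  lies in a proper affine subspace, which has no interior and is therefore null.\<close>

lemma negligible_prism_lowdim:
  fixes A :: "'a::euclidean_space set"
  assumes "aff_dim A < int DIM('a) - 1"
  shows "negligible (prism n A)"
proof (cases "A = {}")
  case False
  then obtain a where a: "a \<in> A" by auto
  let ?H = "affine hull insert (a + n) A"
  have "prism n A \<subseteq> ?H"
  proof
    fix z assume "z \<in> prism n A"
    then obtain y t where y: "y \<in> A" and z: "z = y + t *\<^sub>R n" by (rule prismE)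
    have "y + t *\<^sub>R ((a + n) - a) \<in> ?H"
      using y a by (intro mem_affine_3_minus) (auto intro: hull_inc)
    then show "z \<in> ?H" using z by simp
  qed
  moreover have "aff_dim ?H < int DIM('a)"
    using assms by (simp add: aff_dim_insert)
  then have "negligible ?H"
    using aff_dim_nonempty_interior[of ?H] negligible_convex_interior[of ?H] affine_imp_convex by fastforce
  ultimately show ?thesis by (rule negligible_subset[rotated])
qed (simp add: prism_def)

text \<open>The affine hull of \<open>F\<close> is a hyperplane, whose normalized normal shows that
  the choice in \<open>unit_normal\<close> is not vacuous. Orthogonality extends to the affine hull
  because \<open>F\<close> lies in a hyperplane with normal \<open>unit_normal F\<close>.\<close>

lemma unit_normal:
  fixes F :: "'a::euclidean_space set"
  assumes "aff_dim F = int DIM('a) - 1"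
  shows "norm (unit_normal F) = 1"
    and "y \<in> affine hull F \<Longrightarrow> z \<in> affine hull F \<Longrightarrow> inner (unit_normal F) (y - z) = 0"
proof -
  obtain a b where ab: "a \<noteq> 0" "affine hull F = {x. inner a x = b}"
    using assms aff_dim_eq_hyperplane[of F] by auto
  have "\<exists>n. norm n = 1 \<and> (\<forall>y\<in>F. \<forall>z\<in>F. inner n (y - z) = 0)"
  proof (intro exI conjI ballI)
    show "norm (a /\<^sub>R norm a) = 1" using ab(1) by simp
    fix y z assume "y \<in> F" "z \<in> F"
    then have "inner a y = b" "inner a z = b" using ab(2) hull_subset[of F affine] by auto
    then show "inner (a /\<^sub>R norm a) (y - z) = 0" by (simp add: inner_diff_right)
  qed
  from someI_ex[OF this]
  have n: "norm (unit_normal F) = 1" "\<forall>y\<in>F. \<forall>z\<in>F. inner (unit_normal F) (y - z) = 0"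
    unfolding unit_normal_def by blast+
  show "norm (unit_normal F) = 1" by (rule n)
  assume y: "y \<in> affine hull F" and z: "z \<in> affine hull F"
  obtain w where w: "w \<in> F" using y by (metis affine_hull_empty all_not_in_conv)
  have "affine hull F \<subseteq> {x. inner (unit_normal F) x = inner (unit_normal F) w}"
  proof (intro hull_minimal affine_hyperplane subsetI)
    fix v assume "v \<in> F"
    then have "inner (unit_normal F) (v - w) = 0" using n(2) w by blast
    then show "v \<in> {x. inner (unit_normal F) x = inner (unit_normal F) w}"
      by (simp add: inner_diff_right)
  qed
  then have "y \<in> {x. inner (unit_normal F) x = inner (unit_normal F) w}"
    "z \<in> {x. inner (unit_normal F) x = inner (unit_normal F) w}"
    using y z by blast+
  then show "inner (unit_normal F) (y - z) = 0"
    by (simp add: inner_diff_right)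
qed

text \<open>By Pythagoras, any tangential displacement only increases the distance. Hence
  \<open>closest_point\<close> recovers the base point of every point of the prism.\<close>

lemma closest_point_prism:
  fixes F :: "'a::euclidean_space set"
  assumes F: "aff_dim F = int DIM('a) - 1" and y: "y \<in> F"
  shows "closest_point (affine hull F) (y + t *\<^sub>R unit_normal F) = y"
proof (rule closest_point_unique[symmetric])
  show yF: "y \<in> affine hull F" using y by (rule hull_inc)
  show "\<forall>z\<in>affine hull F. dist (y + t *\<^sub>R unit_normal F) y \<le> dist (y + t *\<^sub>R unit_normal F) z"
  proof
    fix z assume "z \<in> affine hull F"
    then have o: "real_inner_class.orthogonal (y - z) (t *\<^sub>R unit_normal F)"
      using unit_normal(2)[OF F yF] by (auto simp: real_inner_class.orthogonal_def inner_commute)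
    have "(norm (t *\<^sub>R unit_normal F))\<^sup>2 \<le> (norm ((y - z) + t *\<^sub>R unit_normal F))\<^sup>2"
      using norm_add_Pythagorean[OF o] by simp
    then have "norm (t *\<^sub>R unit_normal F) \<le> norm ((y - z) + t *\<^sub>R unit_normal F)"
      by (rule power2_le_imp_le) simp
    then show "dist (y + t *\<^sub>R unit_normal F) y \<le> dist (y + t *\<^sub>R unit_normal F) z"
      by (simp add: dist_norm algebra_simps)
  qed
qed (auto simp: affine_imp_convex closed_affine_hull)

text \<open>The prism contains \<open>F\<close> and a point off the affine hull of \<open>F\<close>,
  so it has full dimension; a convex set of full dimension has interior points.\<close>

lemma interior_prism_nonempty:
  fixes F :: "'a::euclidean_space set"
  assumes F: "aff_dim F = int DIM('a) - 1" and cv: "convex F" and y: "y \<in> F"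
  shows "interior (prism (unit_normal F) F) \<noteq> {}"
proof -
  let ?n = "unit_normal F" and ?P = "prism (unit_normal F) F"
  have "y + ?n \<notin> affine hull F"
  proof
    assume "y + ?n \<in> affine hull F"
    then have "inner ?n (y + ?n - y) = 0"
      using y by (intro unit_normal(2)[OF F]) (auto intro: hull_inc)
    then show False using unit_normal(1)[OF F] by auto
  qed
  then have "aff_dim (insert (y + ?n) F) = int DIM('a)"
    using F by (simp add: aff_dim_insert)
  moreover have "insert (y + ?n) F \<subseteq> ?P"
    using y hull_subset prismI[OF y, of 1 ?n] prismI[of _ F 0 ?n] by auto
  ultimately have "aff_dim ?P = int DIM('a)"
    using aff_dim_subset aff_dim_le_DIM by (metis order_antisym)
  then have "affine hull ?P = UNIV" "?P \<noteq> {}"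
    using aff_dim_eq_full prismI[OF y, of 0] by auto
  then show ?thesis
    using rel_interior_interior rel_interior_eq_empty convex_prism[OF cv] by metis
qed

lemma flat_integral_nonneg:
  fixes F :: "'a::euclidean_space set"
  assumes "aff_dim F = int DIM('a) - 1" "\<And>y. y \<in> F \<Longrightarrow> 0 \<le> f y"
  shows "0 \<le> flat_integral F f"
  unfolding flat_integral_prism set_lebesgue_integral_def
  by (rule Bochner_Integration.integral_nonneg) (use assms in \<open>auto simp: indicator_def closest_point_prism elim!: prismE\<close>)

text \<open>The integrand extended to the prism is continuous, and a compact convex set with
  nonempty interior is the closure of its interior. So \<open>p\<close> qualifies for
  \<open>set_integral_pos\<close> although it lies on the base of the prism.\<close>

lemma flat_integral_pos:
  fixes F :: "'a::euclidean_space set"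
  assumes F: "aff_dim F = int DIM('a) - 1" "compact F" "convex F"
    and f: "continuous_on F f" "\<And>y. y \<in> F \<Longrightarrow> 0 \<le> f y"
    and p: "p \<in> F" "0 < f p"
  shows "0 < flat_integral F f"
  unfolding flat_integral_prism
proof (rule set_integral_pos)
  let ?P = "prism (unit_normal F) F" and ?c = "closest_point (affine hull F)"
  note cp = compact_prism[OF F(2), of "unit_normal F"] and cv = convex_prism[OF F(3), of "unit_normal F"]
  show "bounded ?P" using cp by (rule compact_imp_bounded)
  show "?P \<in> sets lebesgue" using lmeasurable_prism[OF F(3) compact_imp_bounded[OF F(2)]] by blast
  have im: "?c ` ?P \<subseteq> F" using closest_point_prism[OF F(1)] by (auto elim!: prismE)
  have cl: "closure ?P = ?P" using cp by (simp add: compact_imp_closed)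
  show "continuous_on (closure ?P) (\<lambda>z. f (?c z))"
    unfolding cl
  proof (rule continuous_on_compose2[OF f(1) _ im])
    show "continuous_on ?P ?c"
      using p(1) by (intro continuous_on_closest_point) (auto simp: affine_imp_convex closed_affine_hull)
  qed
  show "0 \<le> f (?c z)" if "z \<in> ?P" for z using im that f(2) by blast
  have "p \<in> ?P" using prismI[OF p(1), of 0] by simp
  then show "p \<in> closure (interior ?P)"
    using convex_closure_interior[OF cv interior_prism_nonempty[OF F(1,3) p(1)]] cl by simp
  show "0 < f (?c p)" using closest_point_prism[OF F(1) p(1), of 0] p(2) by simp
qed

text \<open>Prisms over disjoint pieces are disjoint because the base point can be recovered, and
  the prisms over the lower-dimensional exceptional sets are null. The weight of a piece is the
  volume of its prism of height 1, that is, its surface area.\<close>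

lemma flat_integral_piecewise_const:
  fixes F :: "'a::euclidean_space set"
  assumes F: "aff_dim F = int DIM('a) - 1"
    and \<K>: "finite \<K>" "disjoint \<K>" "\<And>K. K \<in> \<K> \<Longrightarrow> convex K \<and> bounded K \<and> K \<subseteq> F"
    and null: "finite \<E>" "F - \<Union>\<K> \<subseteq> \<Union>\<E>" "\<And>E. E \<in> \<E> \<Longrightarrow> aff_dim E < int DIM('a) - 1"
    and f: "\<And>K y. K \<in> \<K> \<Longrightarrow> y \<in> K \<Longrightarrow> f y = c K"
  shows "flat_integral F f = (\<Sum>K\<in>\<K>. c K * measure lebesgue (prism (unit_normal F) K))"
  unfolding flat_integral_prism
proof (rule set_integral_piecewise_const)
  let ?n = "unit_normal F"
  show "finite \<K>" by fact
  show "disjoint_family_on (prism ?n) \<K>"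
    unfolding disjoint_family_on_def
  proof (intro ballI impI, rule ccontr)
    fix K L assume KL: "K \<in> \<K>" "L \<in> \<K>" "K \<noteq> L" "prism ?n K \<inter> prism ?n L \<noteq> {}"
    then obtain y s z t where *: "y \<in> K" "z \<in> L" "y + s *\<^sub>R ?n = z + t *\<^sub>R ?n"
      by (metis disjoint_iff prismE)
    then have "y = z"
      using closest_point_prism[OF F, of y s] closest_point_prism[OF F, of z t] \<K>(3) KL(1,2) by auto
    then show False using \<K>(2) KL(1-3) *(1,2) by (auto simp: disjoint_def)
  qed
  show "prism ?n K \<in> lmeasurable" if "K \<in> \<K>" for K using lmeasurable_prism \<K>(3) that by blast
  show "prism ?n K \<subseteq> prism ?n F" if "K \<in> \<K>" for K using \<K>(3)[OF that] by (intro prism_mono) blast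
  show "negligible (prism ?n F - (\<Union>K\<in>\<K>. prism ?n K))"
  proof (rule negligible_subset)
    show "negligible (\<Union>E\<in>\<E>. prism ?n E)"
      using null(1,3) by (intro negligible_Union) (auto simp: negligible_prism_lowdim)
    show "prism ?n F - (\<Union>K\<in>\<K>. prism ?n K) \<subseteq> (\<Union>E\<in>\<E>. prism ?n E)"
    proof
      fix z assume z: "z \<in> prism ?n F - (\<Union>K\<in>\<K>. prism ?n K)"
      then obtain y t where y: "y \<in> F" "t \<in> {0..1}" "z = y + t *\<^sub>R ?n" by (auto elim: prismE)
      then have "y \<notin> \<Union>\<K>" using z prismI by blast
      then obtain E where "E \<in> \<E>" "y \<in> E" using y(1) null(2) by blast
      then show "z \<in> (\<Union>E\<in>\<E>. prism ?n E)" using y prismI by blast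
    qed
  qed
  show "f (closest_point (affine hull F) z) = c K" if "K \<in> \<K>" "z \<in> prism ?n K" for K z
    using that(2)
  proof (rule prismE)
    fix y t assume y: "y \<in> K" "z = y + t *\<^sub>R ?n"
    then have "y \<in> F" using \<K>(3) that(1) by auto
    then show ?thesis using closest_point_prism[OF F, of y t] f[OF that(1)] y by simp
  qed
qed

text \<open>Derivatives within \<open>F\<close> need not be unique as linear maps, since
  \<open>F\<close> may be flat. Restricting \<open>f\<close> to the segment from \<open>y\<close> to
  \<open>z\<close> gives a function on \<open>{0..1}\<close> whose one-sided derivative at 0 is
  unique.\<close>

lemma derivative_on_convex_unique:
  fixes f :: "'a::euclidean_space \<Rightarrow> real"
  assumes F: "convex F" "y \<in> F" "z \<in> F"
    and "(f has_derivative D) (at y within F)" "(f has_derivative D') (at y within F)"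
  shows "D (z - y) = D' (z - y)"
proof -
  let ?p = "\<lambda>t. y + t *\<^sub>R (z - y)"
  have im: "?p ` {0..1} \<subseteq> F"
  proof clarify
    fix t :: real assume "t \<in> {0..1}"
    then have "(1 - t) *\<^sub>R y + t *\<^sub>R z \<in> F" using F by (intro convexD) auto
    then show "?p t \<in> F" by (simp add: algebra_simps)
  qed
  have "((\<lambda>t. f (?p t)) has_vector_derivative E (z - y)) (at 0 within {0..1})"
    if E: "(f has_derivative E) (at y within F)" for E
  proof -
    have "(?p has_derivative (\<lambda>t. t *\<^sub>R (z - y))) (at 0 within {0..1})"
      by (auto intro!: derivative_eq_intros)
    moreover have "(f has_derivative E) (at (?p 0) within ?p ` {0..1})"
      using E im by (auto intro: has_derivative_subset)
    ultimately have "((\<lambda>t. f (?p t)) has_derivative (\<lambda>t. E (t *\<^sub>R (z - y)))) (at 0 within {0..1})"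
      by (rule has_derivative_in_compose)
    then show ?thesis
      using linear_scale[OF has_derivative_linear[OF E]] by (simp add: has_vector_derivative_def)
  qed
  then show ?thesis
    using assms(4,5) vector_derivative_unique_within_closed_interval[of 0 1 0 "\<lambda>t. f (?p t)"] by auto
qed

text \<open>The constant value is the projection of \<open>b\<close> onto the direction space of the
  facet: the normal part of \<open>b\<close> contributes only a constant on \<open>F\<close>.
  Uniqueness is needed because \<open>surface_grad\<close> is a definite description over both the
  facet and the vector.\<close>

lemma surface_grad_affine:
  fixes \<Omega> :: "'a::euclidean_space set"
  assumes F: "F facet_of closure \<Omega>" and K: "K \<subseteq> F" "rel_interior K = K" "aff_dim K = aff_dim F"
    and cv: "convex F"
    and f: "\<And>y. y \<in> K \<Longrightarrow> f y = a + inner b y"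
  obtains D where "\<And>y. y \<in> K \<Longrightarrow> surface_grad \<Omega> f y = D"
proof (cases "K = {}")
  case True
  then show ?thesis using that by auto
next
  case False
  then obtain y0 where y0: "y0 \<in> K" by auto
  let ?V = "\<lambda>y. span ((\<lambda>z. z - y) ` F)"
  have hull: "affine hull K = affine hull F"
    using K False by (intro affine_dim_equal hull_mono) auto
  have ri: "K \<subseteq> rel_interior F"
    using subset_rel_interior[OF K(1) hull] K(2) by simp
  \<comment> \<open>The direction space of \<open>F\<close> does not depend on the base
    point.\<close>
  have Vsub: "?V y \<subseteq> ?V y'" if "y \<in> F" "y' \<in> F" for y y'
  proof (rule span_minimal[OF _ subspace_span], clarify)
    fix z assume "z \<in> F"
    then have "(z - y') - (y - y') \<in> ?V y'" using that by (intro span_diff span_base) auto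
    then show "z - y \<in> ?V y'" by simp
  qed
  obtain D w where D: "D \<in> ?V y0" "\<And>v. v \<in> ?V y0 \<Longrightarrow> real_inner_class.orthogonal w v" "b = D + w"
    using orthogonal_subspace_decomp_exists by metis
  have "surface_grad \<Omega> f y = D" if y: "y \<in> K" for y
  proof -
    have yF: "y \<in> F" and y0F: "y0 \<in> F" using y y0 K(1) by auto
    have V: "?V y = ?V y0" using Vsub yF y0F by blast
    \<comment> \<open>\<open>K\<close> is relatively open in the affine hull of \<open>F\<close>, so
      near \<open>y\<close> all points of \<open>F\<close> belong to \<open>K\<close> and
      \<open>f\<close> is affine there.\<close>
    obtain e where e: "e > 0" "ball y e \<inter> affine hull F \<subseteq> K"
      using y K(2) hull mem_rel_interior_ball[of y K] by metis
    have "((\<lambda>z. (a + inner w y) + inner D z) has_derivative (\<lambda>v. inner D v)) (at y within F)"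
      by (auto intro!: derivative_eq_intros)
    then have fD: "(f has_derivative (\<lambda>v. inner D v)) (at y within F)"
    proof (rule has_derivative_transform_within[OF _ e(1) yF])
      fix z assume z: "z \<in> F" "dist z y < e"
      then have "z \<in> K" using e(2) hull_inc[of z F affine] by (auto simp: dist_commute)
      then have "f z = a + inner D z + inner w z" using f D(3) by (simp add: inner_add_left)
      moreover have "z - y \<in> ?V y0" using z V by (metis imageI span_base)
      then have "inner w (z - y) = 0" using D(2) by (simp add: real_inner_class.orthogonal_def)
      ultimately show "(a + inner w y) + inner D z = f z" by (simp add: inner_diff_right)
    qed
    show ?thesis
      unfolding surface_grad_def
    proof (rule the_equality)
      show "\<exists>F. F facet_of closure \<Omega> \<and> y \<in> rel_interior F \<and> D \<in> span ((\<lambda>z. z - y) ` F)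
          \<and> (f has_derivative (\<lambda>v. inner D v)) (at y within F)"
        using F ri y D(1) V fD by blast
    next
      fix D'
      assume "\<exists>F. F facet_of closure \<Omega> \<and> y \<in> rel_interior F \<and> D' \<in> span ((\<lambda>z. z - y) ` F)
          \<and> (f has_derivative (\<lambda>v. inner D' v)) (at y within F)"
      then obtain F' where F': "F' facet_of closure \<Omega>" "y \<in> rel_interior F'" "D' \<in> span ((\<lambda>z. z - y) ` F')"
          "(f has_derivative (\<lambda>v. inner D' v)) (at y within F')" by blast
      \<comment> \<open>Faces whose relative interiors share a point coincide, so the facet is
        determined by \<open>y\<close>.\<close>
      have "F' = F"
        using F F'(1,2) ri y by (intro face_of_eq[of _ "closure \<Omega>"]) (auto simp: facet_of_def)
      with F' have D': "D' \<in> ?V y" "(f has_derivative (\<lambda>v. inner D' v)) (at y within F)" by auto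
      have "inner D' (z - y) = inner D (z - y)" if "z \<in> F" for z
        by (rule derivative_on_convex_unique[OF cv yF that D'(2) fD])
      then have "real_inner_class.orthogonal (D' - D) v" if "v \<in> (\<lambda>z. z - y) ` F" for v
        using that by (auto simp: real_inner_class.orthogonal_def inner_diff_left)
      moreover have "D' - D \<in> ?V y" using D(1) D'(1) V by (intro span_diff) auto
      ultimately have "real_inner_class.orthogonal (D' - D) (D' - D)" using orthogonal_to_span by metis
      then show "D' = D" by (simp add: real_inner_class.orthogonal_def)
    qed
  qed
  then show ?thesis by (rule that)
qed

section \<open>Mass and stiffness matrices\<close>

text \<open>The closure is a full-dimensional polyhedron, so its relative frontier is the
  topological one, and the relative frontier of a polyhedron is the union of its facets.\<close>

lemma convex_polyhedral_domain_closure: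
  fixes \<Omega> :: "'a::euclidean_space set"
  assumes "convex_polyhedral_domain \<Omega>"
  shows "compact (closure \<Omega>)" "convex (closure \<Omega>)" "aff_dim (closure \<Omega>) = int DIM('a)"
    "interior (closure \<Omega>) = \<Omega>" "finite {F. F facet_of closure \<Omega>}"
    "frontier \<Omega> = \<Union>{F. F facet_of closure \<Omega>}"
proof -
  have \<Omega>: "open \<Omega>" "\<Omega> \<noteq> {}" "convex \<Omega>" "bounded \<Omega>" "polyhedron (closure \<Omega>)"
    using assms by (auto simp: convex_polyhedral_domain_def)
  show "compact (closure \<Omega>)" "convex (closure \<Omega>)" "finite {F. F facet_of closure \<Omega>}"
    using \<Omega> by (auto intro: finite_polyhedron_facets convex_closure)
  show int: "interior (closure \<Omega>) = \<Omega>"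
    using convex_interior_closure[OF \<Omega>(3)] \<Omega>(1) by (simp add: interior_open)
  then have ne: "interior (closure \<Omega>) \<noteq> {}" using \<Omega>(2) by simp
  then show "aff_dim (closure \<Omega>) = int DIM('a)" by (rule aff_dim_nonempty_interior)
  have "rel_frontier (closure \<Omega>) = frontier \<Omega>"
    using rel_interior_nonempty_interior[OF ne] int \<Omega>(1)
    by (simp add: rel_frontier_def frontier_def interior_open)
  then show "frontier \<Omega> = \<Union>{F. F facet_of closure \<Omega>}"
    using rel_frontier_of_polyhedron[OF \<Omega>(5)] by simp
qed

lemma facet_of_domain:
  fixes \<Omega> :: "'a::euclidean_space set"
  assumes "convex_polyhedral_domain \<Omega>" "F facet_of closure \<Omega>"
  shows "aff_dim F = int DIM('a) - 1" "compact F" "convex F" "F \<subseteq> frontier \<Omega>"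
  using assms convex_polyhedral_domain_closure[OF assms(1)]
  by (auto simp: facet_of_def intro: face_of_imp_compact face_of_imp_convex)

lemma mesh_vertices_subset:
  assumes "simplicial_partition k S \<T>"
  shows "mesh_vertices \<T> \<subseteq> S"
  using assms by (auto simp: simplicial_partition_def mesh_vertices_def extreme_point_of_def)

text \<open>Lumping leaves the integral of \<open>\<chi> i\<close> on the diagonal. It is positive
  because \<open>\<chi> i\<close> is nonnegative and equals 1 at \<open>x i\<close>.\<close>

lemma bulk_mass_diagonal:
  fixes \<Omega> :: "'a::euclidean_space set"
  assumes dom: "convex_polyhedral_domain \<Omega>" and part: "simplicial_partition k (closure \<Omega>) \<T>"
    and vert: "x ` {..<N} = mesh_vertices \<T>" and basis: "nodal_basis (closure \<Omega>) \<T> N x \<chi>"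
  obtains d where "\<forall>i<N. 0 < d i"
    "\<forall>i<N. \<forall>j<N. bulk_mass \<Omega> N x \<chi> $$ (i, j) = (if i = j then d i else 0)"
proof (rule that; intro allI impI)
  have \<Omega>: "open \<Omega>" "bounded \<Omega>" using dom by (auto simp: convex_polyhedral_domain_def)
  show "0 < (LINT y:\<Omega>|lebesgue. \<chi> i y)" if i: "i < N" for i
  proof (rule set_integral_pos)
    show "bounded \<Omega>" "\<Omega> \<in> sets lebesgue" using \<Omega> by auto
    show "continuous_on (closure \<Omega>) (\<chi> i)" using basis i by (auto simp: nodal_basis_def p1_space_def)
    show "0 \<le> \<chi> i y" if "y \<in> \<Omega>" for y
      using nodal_basis_nonneg[OF basis part _ i] vert that closure_subset by blast
    show "x i \<in> closure (interior \<Omega>)"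
      using vert i mesh_vertices_subset[OF part] \<Omega>(1) by (auto simp: interior_open)
    show "0 < \<chi> i (x i)" using basis i by (auto simp: nodal_basis_def)
  qed
  show "bulk_mass \<Omega> N x \<chi> $$ (i, j) = (if i = j then LINT y:\<Omega>|lebesgue. \<chi> i y else 0)"
    if "i < N" "j < N" for i j
    using that nodal_interpolation_basis_product[OF basis that]
    by (auto simp: bulk_mass_def set_lebesgue_integral_def)
qed

text \<open>As in the bulk: a facet containing \<open>x i\<close> contributes a positive amount,
  every other facet a nonnegative one.\<close>

lemma surface_mass_diagonal:
  fixes \<Omega> :: "'a::euclidean_space set"
  assumes dom: "convex_polyhedral_domain \<Omega>" and part: "simplicial_partition k (frontier \<Omega>) \<T>"
    and vert: "x ` {..<N} = mesh_vertices \<T>" and basis: "nodal_basis (frontier \<Omega>) \<T> N x \<chi>"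
  obtains d where "\<forall>i<N. 0 < d i"
    "\<forall>i<N. \<forall>j<N. surface_mass \<Omega> N x \<chi> $$ (i, j) = (if i = j then d i else 0)"
proof (rule that; intro allI impI)
  note cl = convex_polyhedral_domain_closure[OF dom]
  show "0 < surface_integral \<Omega> (\<chi> i)" if i: "i < N" for i
  proof -
    have nn: "0 \<le> \<chi> i y" if "y \<in> frontier \<Omega>" for y
      using nodal_basis_nonneg[OF basis part _ i that] vert by simp
    have "x i \<in> frontier \<Omega>" using vert i mesh_vertices_subset[OF part] by auto
    then obtain F where F: "F facet_of closure \<Omega>" "x i \<in> F" using cl(6) by auto
    note fd = facet_of_domain[OF dom]
    have "0 < flat_integral F (\<chi> i)"
    proof (rule flat_integral_pos)
      show "continuous_on F (\<chi> i)"
        using basis i fd(4)[OF F(1)] by (auto simp: nodal_basis_def p1_space_def intro: continuous_on_subset)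
      show "0 < \<chi> i (x i)" using basis i by (auto simp: nodal_basis_def)
    qed (use F fd[OF F(1)] nn in auto)
    moreover have "0 \<le> flat_integral F' (\<chi> i)" if "F' facet_of closure \<Omega>" for F'
      using fd[OF that] nn by (intro flat_integral_nonneg) auto
    ultimately show ?thesis
      unfolding surface_integral_def using F(1) cl(5) by (intro sum_pos2[where i = F]) auto
  qed
  show "surface_mass \<Omega> N x \<chi> $$ (i, j) = (if i = j then surface_integral \<Omega> (\<chi> i) else 0)"
    if "i < N" "j < N" for i j
    using that nodal_interpolation_basis_product[OF basis that]
    by (auto simp: surface_mass_def surface_integral_def flat_integral_def set_lebesgue_integral_def)
qed

text \<open>A weighted Gram matrix has a weighted sum of squared norms as its quadratic form. For
  stiffness matrices, \<open>k\<close> runs over elements and \<open>b i k\<close> is the constant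
  gradient of basis function \<open>i\<close> there.\<close>

lemma gram_form:
  fixes b :: "nat \<Rightarrow> 'k \<Rightarrow> 'a::real_inner"
  assumes L: "\<And>i j. i < n \<Longrightarrow> j < n \<Longrightarrow> L i j = (\<Sum>k\<in>I. \<mu> k * inner (b j k) (b i k))"
  shows "(\<Sum>i<n. v i * (\<Sum>j<n. L i j * v j)) = (\<Sum>k\<in>I. \<mu> k * (norm (\<Sum>i<n. v i *\<^sub>R b i k))\<^sup>2)"
proof -
  have "(\<Sum>i<n. v i * (\<Sum>j<n. L i j * v j))
      = (\<Sum>i<n. \<Sum>j<n. \<Sum>k\<in>I. \<mu> k * (v i * v j * inner (b j k) (b i k)))"
    unfolding sum_distrib_left using L by (intro sum.cong) (auto simp: sum_distrib_left sum_distrib_right mult_ac)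
  also have "\<dots> = (\<Sum>i<n. \<Sum>k\<in>I. \<Sum>j<n. \<mu> k * (v i * v j * inner (b j k) (b i k)))"
    by (intro sum.cong sum.swap refl)
  also have "\<dots> = (\<Sum>k\<in>I. \<Sum>i<n. \<Sum>j<n. \<mu> k * (v i * v j * inner (b j k) (b i k)))"
    by (rule sum.swap)
  also have "\<dots> = (\<Sum>k\<in>I. \<mu> k * (norm (\<Sum>i<n. v i *\<^sub>R b i k))\<^sup>2)"
    by (intro sum.cong refl)
       (simp add: power2_norm_eq_inner inner_sum_left inner_sum_right sum_distrib_left mult_ac inner_commute)
  finally show ?thesis .
qed

text \<open>Gradients are constant on each simplex, and the simplices fill \<Omega> up to their
  frontiers, which are null by convexity. The weight \<open>\<mu> K\<close> is the volume of
  \<open>K\<close>.\<close>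

lemma bulk_stiffness_gram:
  fixes \<Omega> :: "'a::euclidean_space set"
  assumes dom: "convex_polyhedral_domain \<Omega>"
    and part: "simplicial_partition (int DIM('a)) (closure \<Omega>) \<T>"
    and basis: "nodal_basis (closure \<Omega>) \<T> N x \<chi>"
  obtains \<mu> a b where "\<forall>K\<in>\<T>. 0 < \<mu> K"
    "\<forall>i<N. \<forall>K\<in>\<T>. \<forall>y\<in>closure K. \<chi> i y = a i K + inner (b i K) y"
    "\<forall>i<N. \<forall>j<N. bulk_stiffness \<Omega> N \<chi> $$ (i, j) = (\<Sum>K\<in>\<T>. \<mu> K * inner (b j K) (b i K))"
proof -
  note cl = convex_polyhedral_domain_closure[OF dom]
  have \<T>: "finite \<T>" "disjoint \<T>" "closure \<Omega> = (\<Union>K\<in>\<T>. closure K)"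
    "\<And>K. K \<in> \<T> \<Longrightarrow> open_simplex (int DIM('a)) K"
    using part by (auto simp: simplicial_partition_def)
  have op: "open K" if "K \<in> \<T>" for K using open_simplex_full_open \<T>(4) that by blast
  \<comment> \<open>An open subset of \<open>closure \<Omega>\<close> lies in the interior of this
    closure, which is \<Omega> itself by convexity.\<close>
  have sub: "K \<subseteq> \<Omega>" if "K \<in> \<T>" for K
    using interior_maximal[OF _ op[OF that], of "closure \<Omega>"] closure_subset \<T>(3) that cl(4) by blast
  have "\<exists>a b. \<forall>y\<in>closure K. \<chi> i y = a + inner b y" if iK: "i < N" "K \<in> \<T>" for i K
  proof -
    have "\<chi> i \<in> p1_space (closure \<Omega>) \<T>" using basis iK by (auto simp: nodal_basis_def)
    moreover have "closure K \<subseteq> closure \<Omega>" using \<T>(3) iK by auto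
    ultimately show ?thesis using p1_space_affine_on_closure[OF _ iK(2)] by metis
  qed
  then obtain a b where ab: "\<And>i K y. i < N \<Longrightarrow> K \<in> \<T> \<Longrightarrow> y \<in> closure K \<Longrightarrow> \<chi> i y = a i K + inner (b i K) y"
    by metis
  have lm: "K \<in> lmeasurable" if "K \<in> \<T>" for K
    using open_simplexD(1,2)[OF \<T>(4)[OF that]] by (rule measurable_convex)
  show ?thesis
  proof (rule that; intro allI ballI impI)
    show "0 < measure lebesgue K" if "K \<in> \<T>" for K
    proof -
      have "K \<noteq> {}" using open_simplexD(6)[OF \<T>(4)[OF that]] by auto
      then have "measure lebesgue K \<noteq> 0"
        using op[OF that] lm[OF that] open_not_negligible negligible_iff_measure by blast
      then show ?thesis using measure_nonneg[of lebesgue K] by linarith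
    qed
    show "\<chi> i y = a i K + inner (b i K) y" if "i < N" "K \<in> \<T>" "y \<in> closure K" for i K y
      using ab that by blast
    show "bulk_stiffness \<Omega> N \<chi> $$ (i, j) = (\<Sum>K\<in>\<T>. measure lebesgue K * inner (b j K) (b i K))"
      if "i < N" "j < N" for i j
    proof -
      have gr: "grad (\<chi> i) y = b i K" if "i < N" "K \<in> \<T>" "y \<in> K" for i K y
        using that closure_subset by (intro grad_affine[OF op]) (auto intro!: ab)
      have "(LINT y:\<Omega>|lebesgue. inner (grad (\<chi> j) y) (grad (\<chi> i) y))
          = (\<Sum>K\<in>\<T>. inner (b j K) (b i K) * measure lebesgue K)"
      proof (rule set_integral_piecewise_const)
        show "disjoint_family_on (\<lambda>K. K) \<T>"
          using \<T>(2) by (auto simp: disjoint_def disjoint_family_on_def)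
        show "negligible (\<Omega> - (\<Union>K\<in>\<T>. K))"
        proof (rule negligible_subset)
          show "negligible (\<Union>K\<in>\<T>. frontier K)"
            using \<T>(1,4) open_simplexD(1) negligible_convex_frontier by (intro negligible_Union) auto
          show "\<Omega> - (\<Union>K\<in>\<T>. K) \<subseteq> (\<Union>K\<in>\<T>. frontier K)"
          proof
            fix y assume y: "y \<in> \<Omega> - (\<Union>K\<in>\<T>. K)"
            then have "y \<in> (\<Union>K\<in>\<T>. closure K)"
              using subsetD[OF closure_subset, of y \<Omega>] unfolding \<T>(3)[symmetric] by simp
            then obtain K where K: "K \<in> \<T>" "y \<in> closure K" by blast
            then have "y \<in> frontier K"
              using y interior_open[OF op[OF K(1)]] by (simp add: frontier_def)
            then show "y \<in> (\<Union>K\<in>\<T>. frontier K)" using K(1) by blast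
          qed
        qed
      qed (use \<T>(1) lm sub gr that in auto)
      then show ?thesis using that by (simp add: bulk_stiffness_def mult.commute)
    qed
  qed
qed

lemma bulk_stiffness_symmetric:
  "i < N \<Longrightarrow> j < N \<Longrightarrow> bulk_stiffness \<Omega> N \<chi> $$ (i, j) = bulk_stiffness \<Omega> N \<chi> $$ (j, i)"
  by (simp add: bulk_stiffness_def inner_commute)

lemma surface_stiffness_symmetric:
  "i < N \<Longrightarrow> j < N \<Longrightarrow> surface_stiffness \<Omega> N \<chi> $$ (i, j) = surface_stiffness \<Omega> N \<chi> $$ (j, i)"
  by (simp add: surface_stiffness_def inner_commute)

text \<open>If all vertices of \<open>closure K\<close> were in \<open>S\<close>, they would lie in
  the convex set \<open>closure K'\<close>, and so would their hull \<open>closure K\<close>,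
  against the dimensions.\<close>

lemma open_simplex_vertex_outside_face:
  assumes K: "open_simplex k K" and K': "open_simplex k' K'" and "k' < k"
    and face: "closure K' = closure K \<inter> S"
  obtains w where "w extreme_point_of closure K" "w \<notin> S"
proof (rule ccontr)
  assume "\<not> thesis"
  then have "{w. w extreme_point_of closure K} \<subseteq> closure K'"
    using that face by (auto simp: extreme_point_of_def)
  then have "convex hull {w. w extreme_point_of closure K} \<subseteq> closure K'"
    using open_simplexD(3)[OF K'] by (rule hull_minimal)
  then have "closure K \<subseteq> closure K'"
    using Krein_Milman_Minkowski open_simplexD(3,4)[OF K] by metis
  then have "aff_dim (closure K) \<le> aff_dim (closure K')" by (rule aff_dim_subset)
  then show False
    using open_simplexD(7)[OF K] open_simplexD(7)[OF K'] \<open>k' < k\<close> by simp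
qed

text \<open>
  A discrete function with vanishing energy is constant on every element. Assumption (S2) gives each
  boundary vertex an element with a vertex off the boundary, where a combination of the first \<open>g\<close>
  basis functions vanishes.
\<close>
lemma bulk_stiffness_boundary_block:
  fixes \<Omega> :: "'a::euclidean_space set"
  assumes dom: "convex_polyhedral_domain \<Omega>"
    and part: "simplicial_partition (int DIM('a)) (closure \<Omega>) \<T>"
    and part': "simplicial_partition (int DIM('a) - 1) (frontier \<Omega>) \<T>'"
    and match: "\<forall>K'\<in>\<T>'. \<exists>K\<in>\<T>. closure K' = closure K \<inter> frontier \<Omega>"
    and vert: "x ` {..<n} = mesh_vertices \<T>" "x ` {..<g} = mesh_vertices \<T>'" and g: "g \<le> n"
    and basis: "nodal_basis (closure \<Omega>) \<T> n x \<chi>"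
  shows "0 \<le> (\<Sum>i<g. v i * (\<Sum>j<g. bulk_stiffness \<Omega> n \<chi> $$ (i, j) * v j))"
    and "(\<Sum>i<g. v i * (\<Sum>j<g. bulk_stiffness \<Omega> n \<chi> $$ (i, j) * v j)) = 0 \<Longrightarrow> i < g \<Longrightarrow> v i = 0"
proof -
  obtain \<mu> a b where \<mu>: "\<forall>K\<in>\<T>. 0 < \<mu> K"
    and ab: "\<forall>i<n. \<forall>K\<in>\<T>. \<forall>y\<in>closure K. \<chi> i y = a i K + inner (b i K) y"
    and L: "\<forall>i<n. \<forall>j<n. bulk_stiffness \<Omega> n \<chi> $$ (i, j) = (\<Sum>K\<in>\<T>. \<mu> K * inner (b j K) (b i K))"
    by (rule bulk_stiffness_gram[OF dom part basis])
  have form: "(\<Sum>i<g. v i * (\<Sum>j<g. bulk_stiffness \<Omega> n \<chi> $$ (i, j) * v j))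
      = (\<Sum>K\<in>\<T>. \<mu> K * (norm (\<Sum>i<g. v i *\<^sub>R b i K))\<^sup>2)"
    by (rule gram_form) (use L g in auto)
  have nn: "0 \<le> \<mu> K * (norm (\<Sum>i<g. v i *\<^sub>R b i K))\<^sup>2" if "K \<in> \<T>" for K
    using bspec[OF \<mu> that] by simp
  then show "0 \<le> (\<Sum>i<g. v i * (\<Sum>j<g. bulk_stiffness \<Omega> n \<chi> $$ (i, j) * v j))"
    unfolding form by (rule sum_nonneg)
  assume 0: "(\<Sum>i<g. v i * (\<Sum>j<g. bulk_stiffness \<Omega> n \<chi> $$ (i, j) * v j)) = 0" and i: "i < g"
  have fin: "finite \<T>" using part by (simp add: simplicial_partition_def)
  \<comment> \<open>All weights are positive, so zero energy makes the gradient of the combination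
    vanish on every element.\<close>
  have flat: "(\<Sum>i<g. v i *\<^sub>R b i K) = 0" if "K \<in> \<T>" for K
  proof -
    have "\<mu> K * (norm (\<Sum>i<g. v i *\<^sub>R b i K))\<^sup>2 = 0"
      using 0 that sum_nonneg_eq_0_iff[OF fin, of "\<lambda>K. \<mu> K * (norm (\<Sum>i<g. v i *\<^sub>R b i K))\<^sup>2"] nn
      unfolding form by simp
    then show ?thesis using bspec[OF \<mu> that] by simp
  qed
  have const: "(\<Sum>i<g. v i * \<chi> i y) = (\<Sum>i<g. v i * a i K)" if "K \<in> \<T>" "y \<in> closure K" for K y
  proof -
    have "(\<Sum>i<g. v i * \<chi> i y) = (\<Sum>i<g. v i * a i K + inner (v i *\<^sub>R b i K) y)"
      using ab g that by (intro sum.cong) (auto simp: algebra_simps)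
    also have "\<dots> = (\<Sum>i<g. v i * a i K) + inner (\<Sum>i<g. v i *\<^sub>R b i K) y"
      by (simp add: sum.distrib inner_sum_left)
    finally show ?thesis using flat[OF that(1)] by simp
  qed
  have vertex_value: "(\<Sum>i<g. v i * \<chi> i (x j)) = (if j < g then v j else 0)" if "j < n" for j
  proof -
    have "(\<Sum>i<g. v i * \<chi> i (x j)) = (\<Sum>i<g. if i = j then v j else 0)"
      using basis g that by (intro sum.cong) (auto simp: nodal_basis_def)
    then show ?thesis by simp
  qed
  have "x i \<in> mesh_vertices \<T>'" using vert(2) i by auto
  then obtain K' where K': "K' \<in> \<T>'" "x i \<in> closure K'"
    by (auto simp: mesh_vertices_def extreme_point_of_def)
  obtain K where K: "K \<in> \<T>" "closure K' = closure K \<inter> frontier \<Omega>" using match K'(1) by blast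
  have os: "open_simplex (int DIM('a)) K" "open_simplex (int DIM('a) - 1) K'"
    using part part' K(1) K'(1) by (auto simp: simplicial_partition_def)
  \<comment> \<open>This vertex has an index outside \<open>{..<g}\<close>, so the combination is 0
    there; at \<open>x i\<close> it is \<open>v i\<close>. Both points lie in
    \<open>closure K\<close>, where the combination is constant.\<close>
  obtain w where w: "w extreme_point_of closure K" "w \<notin> frontier \<Omega>"
    by (rule open_simplex_vertex_outside_face[OF os _ K(2)]) simp
  then have "w \<in> x ` {..<n}" using vert(1) K(1) by (auto simp: mesh_vertices_def)
  then obtain j where j: "j < n" "w = x j" by auto
  have "x ` {..<g} \<subseteq> frontier \<Omega>" using vert(2) mesh_vertices_subset[OF part'] by simp
  then have "\<not> j < g" using w(2) j(2) by auto
  moreover have "x j \<in> closure K" "x i \<in> closure K"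
    using w(1) j(2) K'(2) K(2) by (auto simp: extreme_point_of_def)
  ultimately show "v i = 0"
    using const[OF K(1), of "x j"] const[OF K(1), of "x i"] vertex_value[OF j(1)] vertex_value[of i] i g by simp
qed

text \<open>A face contains every relatively open convex part of the polyhedron that it meets, so an
  element meeting \<open>F\<close> lies in \<open>F\<close>. The remaining points of
  \<open>F\<close> lie on relative frontiers of elements, that is, on facets of their
  closures.\<close>

lemma facet_cover:
  fixes \<Omega> :: "'a::euclidean_space set"
  assumes dom: "convex_polyhedral_domain \<Omega>"
    and part: "simplicial_partition (int DIM('a) - 1) (frontier \<Omega>) \<T>"
    and F: "F facet_of closure \<Omega>"
  shows "F - \<Union>{K \<in> \<T>. K \<subseteq> F} \<subseteq> \<Union>(\<Union>K\<in>\<T>. {E. E facet_of closure K})"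
proof
  fix y assume y: "y \<in> F - \<Union>{K \<in> \<T>. K \<subseteq> F}"
  then have "y \<in> frontier \<Omega>" using facet_of_domain(4)[OF dom F] by auto
  then obtain K where K: "K \<in> \<T>" "y \<in> closure K" "closure K \<subseteq> frontier \<Omega>" "open_simplex (int DIM('a) - 1) K"
    using part by (auto simp: simplicial_partition_def)
  note os = open_simplexD[OF K(4)]
  have "y \<notin> K"
  proof
    assume "y \<in> K"
    have "K \<subseteq> closure \<Omega>" using K(3) closure_subset[of K] by (auto simp: frontier_def)
    then have "K \<subseteq> F"
      using F y \<open>y \<in> K\<close> os(8) by (intro subset_of_face_of[of F "closure \<Omega>"]) (auto simp: facet_of_def)
    then show False using y K(1) \<open>y \<in> K\<close> by auto
  qed
  then have "y \<in> rel_frontier (closure K)" using K(2) os(9) by (simp add: rel_frontier_def)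
  then show "y \<in> \<Union>(\<Union>K\<in>\<T>. {E. E facet_of closure K})"
    using rel_frontier_of_polyhedron[OF os(5)] K(1) by auto
qed

lemma surface_stiffness_nonneg:
  fixes \<Omega> :: "'a::euclidean_space set"
  assumes dom: "convex_polyhedral_domain \<Omega>"
    and part: "simplicial_partition (int DIM('a) - 1) (frontier \<Omega>) \<T>"
    and basis: "nodal_basis (frontier \<Omega>) \<T> N x \<chi>"
  shows "0 \<le> (\<Sum>i<N. v i * (\<Sum>j<N. surface_stiffness \<Omega> N \<chi> $$ (i, j) * v j))"
proof -
  note cl = convex_polyhedral_domain_closure[OF dom]
  \<comment> \<open>The surface gradient is constant on each surface element, and the elements exhaust every facet up
    to sets of dimension at most \<open>d - 2\<close>, so the stiffness matrix is a finite weighted Gram matrix.\<close>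
  define D where "D i K = (SOME D. \<forall>y\<in>K. surface_grad \<Omega> (\<chi> i) y = D)" for i K
  define \<K> where "\<K> F = {K \<in> \<T>. K \<subseteq> F}" for F
  define A where "A p = measure lebesgue (prism (unit_normal (fst p)) (snd p))" for p :: "'a set \<times> 'a set"
  \<comment> \<open>The index set consists of pairs of a facet and an element in it, because the
    area \<open>A\<close> is computed with the unit normal of the facet.\<close>
  let ?I = "SIGMA F:{F. F facet_of closure \<Omega>}. \<K> F"
  have \<T>: "finite \<T>" "disjoint \<T>" "frontier \<Omega> = (\<Union>K\<in>\<T>. closure K)"
    "\<And>K. K \<in> \<T> \<Longrightarrow> open_simplex (int DIM('a) - 1) K"
    using part by (auto simp: simplicial_partition_def)
  have D: "surface_grad \<Omega> (\<chi> i) y = D i K"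
    if i: "i < N" and F: "F facet_of closure \<Omega>" and K: "K \<in> \<T>" "K \<subseteq> F" and y: "y \<in> K" for i F K y
  proof -
    have "\<exists>a b. \<forall>y\<in>K. \<chi> i y = a + inner b y"
      using basis i K(1) unfolding nodal_basis_def p1_space_def by blast
    then obtain a b where ab: "\<And>y. y \<in> K \<Longrightarrow> \<chi> i y = a + inner b y" by blast
    note fd = facet_of_domain[OF dom F] and os = open_simplexD[OF \<T>(4)[OF K(1)]]
    have "\<exists>D. \<forall>y\<in>K. surface_grad \<Omega> (\<chi> i) y = D"
      by (rule surface_grad_affine[OF F K(2) os(8) _ fd(3) ab]) (use fd(1) os(6) in auto)
    then have "\<forall>y\<in>K. surface_grad \<Omega> (\<chi> i) y = D i K" unfolding D_def by (rule someI_ex)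
    then show ?thesis using y by blast
  qed
  have L: "surface_stiffness \<Omega> N \<chi> $$ (i, j) = (\<Sum>p\<in>?I. A p * inner (D j (snd p)) (D i (snd p)))"
    if "i < N" "j < N" for i j
  proof -
    have "flat_integral F (\<lambda>y. inner (surface_grad \<Omega> (\<chi> j) y) (surface_grad \<Omega> (\<chi> i) y))
        = (\<Sum>K\<in>\<K> F. inner (D j K) (D i K) * measure lebesgue (prism (unit_normal F) K))"
      if F: "F facet_of closure \<Omega>" for F
    proof (rule flat_integral_piecewise_const)
      show "aff_dim F = int DIM('a) - 1" by (rule facet_of_domain(1)[OF dom F])
      show "finite (\<K> F)" using \<T>(1) by (simp add: \<K>_def)
      show "disjoint (\<K> F)" using \<T>(2) by (auto simp: \<K>_def disjoint_def)
      show "convex K \<and> bounded K \<and> K \<subseteq> F" if "K \<in> \<K> F" for K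
        using that open_simplexD(1,2)[OF \<T>(4)] by (auto simp: \<K>_def)
      let ?E = "\<Union>K\<in>\<T>. {E. E facet_of closure K}"
      show "finite ?E" using \<T>(1,4) open_simplexD(5) finite_polyhedron_facets by blast
      show "F - \<Union>(\<K> F) \<subseteq> \<Union>?E" unfolding \<K>_def by (rule facet_cover[OF dom part F])
      show "aff_dim E < int DIM('a) - 1" if E: "E \<in> ?E" for E
      proof -
        obtain K where "K \<in> \<T>" "E facet_of closure K" using E by blast
        then show ?thesis using open_simplexD(7)[OF \<T>(4)] by (simp add: facet_of_def)
      qed
      show "inner (surface_grad \<Omega> (\<chi> j) y) (surface_grad \<Omega> (\<chi> i) y) = inner (D j K) (D i K)"
        if "K \<in> \<K> F" "y \<in> K" for K y
        using that D[OF \<open>i < N\<close> F] D[OF \<open>j < N\<close> F] by (auto simp: \<K>_def)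
    qed
    then have "surface_stiffness \<Omega> N \<chi> $$ (i, j)
        = (\<Sum>F | F facet_of closure \<Omega>. \<Sum>K\<in>\<K> F. A (F, K) * inner (D j K) (D i K))"
      using that by (simp add: surface_stiffness_def surface_integral_def A_def mult.commute)
    also have "\<dots> = (\<Sum>p\<in>?I. A p * inner (D j (snd p)) (D i (snd p)))"
      using cl(5) \<T>(1) by (subst sum.Sigma) (auto simp: \<K>_def case_prod_beta)
    finally show ?thesis .
  qed
  have "(\<Sum>i<N. v i * (\<Sum>j<N. surface_stiffness \<Omega> N \<chi> $$ (i, j) * v j))
      = (\<Sum>p\<in>?I. A p * (norm (\<Sum>i<N. v i *\<^sub>R D i (snd p)))\<^sup>2)"
    by (rule gram_form) (rule L)
  then show ?thesis by (auto simp: A_def intro!: sum_nonneg)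
qed

section \<open>Matrix calculus\<close>

text \<open>A trivial kernel gives a nonzero determinant, so \<open>mat_inverse\<close> does return
  a matrix and \<open>minv\<close> is meaningful. The hypothesis is on the kernel because that is
  what an energy argument provides.\<close>

lemma minv_mult_vec:
  assumes A: "A \<in> carrier_mat n n" and b: "b \<in> carrier_vec n"
    and ker: "\<And>v. v \<in> carrier_vec n \<Longrightarrow> A *\<^sub>v v = 0\<^sub>v n \<Longrightarrow> v = 0\<^sub>v n"
  shows "minv A \<in> carrier_mat n n" and "A *\<^sub>v (minv A *\<^sub>v b) = b"
proof -
  have "det A \<noteq> 0"
    using ker det_0_iff_vec_prod_zero[OF A] by auto
  then have "A \<in> Units (ring_mat TYPE(real) n undefined)"
    by (rule det_non_zero_imp_unit[OF A])
  then obtain B where B: "mat_inverse A = Some B"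
    using mat_inverse(1)[OF A] by fastforce
  note AB = mat_inverse(2)[OF A B]
  show "minv A \<in> carrier_mat n n"
    using AB B by simp
  have "A *\<^sub>v (B *\<^sub>v b) = (A * B) *\<^sub>v b"
    using A AB b by (metis assoc_mult_mat_vec)
  then show "A *\<^sub>v (minv A *\<^sub>v b) = b"
    using AB B b by simp
qed

lemma index_mult_mat_vec_sum:
  assumes "A \<in> carrier_mat k n" "v \<in> carrier_vec n" "i < k"
  shows "(A *\<^sub>v v) $ i = (\<Sum>j<n. A $$ (i, j) * v $ j)"
  using assms by (auto simp: scalar_prod_def atLeast0LessThan intro!: sum.cong)

lemma diagonal_mult_vec:
  fixes A :: "real mat"
  assumes "A \<in> carrier_mat n n" "v \<in> carrier_vec n" "i < n"
    and "\<forall>i<n. \<forall>j<n. A $$ (i, j) = (if i = j then d i else 0)"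
  shows "(A *\<^sub>v v) $ i = d i * v $ i"
proof -
  have "(A *\<^sub>v v) $ i = (\<Sum>j<n. (if i = j then d i * v $ j else 0))"
    unfolding index_mult_mat_vec_sum[OF assms(1-3)] using assms by (intro sum.cong) auto
  then show ?thesis
    using assms(3) by simp
qed

lemma diagonal_minv:
  fixes A :: "real mat"
  assumes A: "A \<in> carrier_mat n n"
    and d: "\<forall>i<n. \<forall>j<n. A $$ (i, j) = (if i = j then d i else 0)"
    and pos: "\<forall>i<n. 0 < d i"
  shows "minv A \<in> carrier_mat n n"
    and "v \<in> carrier_vec n \<Longrightarrow> i < n \<Longrightarrow> (minv A *\<^sub>v v) $ i = v $ i / d i"
proof -
  have ker: "v = 0\<^sub>v n" if v: "v \<in> carrier_vec n" "A *\<^sub>v v = 0\<^sub>v n" for v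
  proof (rule eq_vecI)
    fix i assume "i < dim_vec (0\<^sub>v n :: real vec)"
    then have i: "i < n" by simp
    have "d i * v $ i = 0"
      using diagonal_mult_vec[OF A v(1) i d] v(2) i by simp
    then show "v $ i = 0\<^sub>v n $ i"
      using pos i by fastforce
  qed (use v in simp)
  show car: "minv A \<in> carrier_mat n n"
    by (rule minv_mult_vec(1)[OF A zero_carrier_vec ker])
  assume v: "v \<in> carrier_vec n" and i: "i < n"
  have "d i * (minv A *\<^sub>v v) $ i = v $ i"
    using diagonal_mult_vec[OF A mult_mat_vec_carrier[OF car v] i d] minv_mult_vec(2)[OF A v ker] by simp
  then show "(minv A *\<^sub>v v) $ i = v $ i / d i"
    using spec[OF pos, of i] i by (simp add: field_simps)
qed

lemma pick_lessThan: "i < g \<Longrightarrow> pick {..<g} i = i"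
proof -
  assume i: "i < g"
  have "{a \<in> {..<g}. a < i} = {..<i}" using i by auto
  then show ?thesis using pick_card_in_set[of i "{..<g}"] i by simp
qed

text \<open>\<open>pick\<close> enumerates the index set in increasing order, and exactly
  \<open>i\<close> elements of \<open>{g..<n}\<close> lie below \<open>g + i\<close>. This is the
  shift by \<open>g\<close> in all interior blocks.\<close>

lemma pick_atLeastLessThan: "i < n - g \<Longrightarrow> pick {g..<n} i = g + i"
proof -
  assume i: "i < n - g"
  have "{a \<in> {g..<n}. a < g + i} = {g..<g + i}" using i by auto
  then show ?thesis using pick_card_in_set[of "g + i" "{g..<n}"] i by simp
qed

lemma submatrix_blocks:
  fixes A :: "real mat"
  assumes A: "A \<in> carrier_mat n n" and g: "g \<le> n"
  shows "submatrix A {..<g} {..<n} \<in> carrier_mat g n"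
    and "submatrix A {g..<n} {..<n} \<in> carrier_mat (n - g) n"
    and "submatrix A {..<g} {..<g} \<in> carrier_mat g g"
    and "submatrix A {..<g} {g..<n} \<in> carrier_mat g (n - g)"
    and "submatrix A {g..<n} {g..<n} \<in> carrier_mat (n - g) (n - g)"
    and "i < g \<Longrightarrow> j < n \<Longrightarrow> submatrix A {..<g} {..<n} $$ (i, j) = A $$ (i, j)"
    and "i < n - g \<Longrightarrow> j < n \<Longrightarrow> submatrix A {g..<n} {..<n} $$ (i, j) = A $$ (g + i, j)"
    and "i < g \<Longrightarrow> j < g \<Longrightarrow> submatrix A {..<g} {..<g} $$ (i, j) = A $$ (i, j)"
    and "i < g \<Longrightarrow> j < n - g \<Longrightarrow> submatrix A {..<g} {g..<n} $$ (i, j) = A $$ (i, g + j)"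
    and "i < n - g \<Longrightarrow> j < n - g \<Longrightarrow> submatrix A {g..<n} {g..<n} $$ (i, j) = A $$ (g + i, g + j)"
proof -
  have d: "dim_row A = n" "dim_col A = n" using A by auto
  have c: "{i. i < n \<and> i \<in> {..<g}} = {..<g}" "{i. i < n \<and> i \<in> {..<n}} = {..<n}"
    "{i. i < n \<and> i \<in> {g..<n}} = {g..<n}" using g by auto
  show "submatrix A {..<g} {..<n} \<in> carrier_mat g n"
    "submatrix A {g..<n} {..<n} \<in> carrier_mat (n - g) n"
    "submatrix A {..<g} {..<g} \<in> carrier_mat g g"
    "submatrix A {..<g} {g..<n} \<in> carrier_mat g (n - g)"
    "submatrix A {g..<n} {g..<n} \<in> carrier_mat (n - g) (n - g)"
    by (auto intro!: carrier_matI simp only: dim_submatrix d c card_lessThan card_atLeastLessThan)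
  show "i < g \<Longrightarrow> j < n \<Longrightarrow> submatrix A {..<g} {..<n} $$ (i, j) = A $$ (i, j)"
    "i < n - g \<Longrightarrow> j < n \<Longrightarrow> submatrix A {g..<n} {..<n} $$ (i, j) = A $$ (g + i, j)"
    "i < g \<Longrightarrow> j < g \<Longrightarrow> submatrix A {..<g} {..<g} $$ (i, j) = A $$ (i, j)"
    "i < g \<Longrightarrow> j < n - g \<Longrightarrow> submatrix A {..<g} {g..<n} $$ (i, j) = A $$ (i, g + j)"
    "i < n - g \<Longrightarrow> j < n - g \<Longrightarrow> submatrix A {g..<n} {g..<n} $$ (i, j) = A $$ (g + i, g + j)"
    using submatrix_index[of i A "{..<g}" j "{..<n}"] submatrix_index[of i A "{g..<n}" j "{..<n}"]
      submatrix_index[of i A "{..<g}" j "{..<g}"] submatrix_index[of i A "{..<g}" j "{g..<n}"]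
      submatrix_index[of i A "{g..<n}" j "{g..<n}"]
    by (simp_all only: d c card_lessThan card_atLeastLessThan pick_lessThan pick_atLeastLessThan)
qed

lemma sum_lessThan_add:
  fixes f :: "nat \<Rightarrow> real"
  shows "(\<Sum>j<g + l. f j) = (\<Sum>j<g. f j) + (\<Sum>j<l. f (g + j))"
  by (induction l) (auto simp: add.assoc)

lemma smult_mat_mult_vec:
  fixes a :: real
  assumes "A \<in> carrier_mat k n" "v \<in> carrier_vec n"
  shows "(a \<cdot>\<^sub>m A) *\<^sub>v v = a \<cdot>\<^sub>v (A *\<^sub>v v)"
  using assms by (intro eq_vecI) auto

text \<open>The matrix has the shape of \<open>S\<close>, with \<open>A\<close> the boundary block
  of the bulk stiffness, \<open>B\<close> that of the bulk mass, \<open>C\<close> the inverse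
  surface mass and \<open>L\<close> the surface stiffness. It is applied factor by factor to avoid
  entries of matrix products.\<close>

lemma boundary_matrix_mult_vec:
  fixes a b :: real
  assumes A: "A \<in> carrier_mat g g" and B: "B \<in> carrier_mat g g" and C: "C \<in> carrier_mat g g"
    and L: "L \<in> carrier_mat g g" and v: "v \<in> carrier_vec g"
  shows "(a \<cdot>\<^sub>m A + b \<cdot>\<^sub>m (B * C * L * C * B)) *\<^sub>v v
    = a \<cdot>\<^sub>v (A *\<^sub>v v) + b \<cdot>\<^sub>v (B *\<^sub>v (C *\<^sub>v (L *\<^sub>v (C *\<^sub>v (B *\<^sub>v v)))))"
proof -
  note BC = mult_carrier_mat[OF B C]
  note BCL = mult_carrier_mat[OF BC L]
  note BCLC = mult_carrier_mat[OF BCL C]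
  note X = mult_carrier_mat[OF BCLC B]
  note Bv = mult_mat_vec_carrier[OF B v]
  note CBv = mult_mat_vec_carrier[OF C Bv]
  note LCBv = mult_mat_vec_carrier[OF L CBv]
  have "(B * C * L * C * B) *\<^sub>v v = B *\<^sub>v (C *\<^sub>v (L *\<^sub>v (C *\<^sub>v (B *\<^sub>v v))))"
    unfolding assoc_mult_mat_vec[OF BCLC B v] assoc_mult_mat_vec[OF BCL C Bv]
      assoc_mult_mat_vec[OF BC L CBv] assoc_mult_mat_vec[OF B C LCBv] ..
  then show ?thesis
    using A X v add_mult_distrib_mat_vec[of "a \<cdot>\<^sub>m A" g g "b \<cdot>\<^sub>m (B * C * L * C * B)" v]
    by (simp add: smult_mat_mult_vec)
qed

lemma scalar_prod_mult_mat_vec_sum: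
  fixes u v :: "real vec"
  assumes "A \<in> carrier_mat k n" "u \<in> carrier_vec k" "v \<in> carrier_vec n"
  shows "u \<bullet> (A *\<^sub>v v) = (\<Sum>i<k. u $ i * (\<Sum>j<n. A $$ (i, j) * v $ j))"
proof -
  have "u \<bullet> (A *\<^sub>v v) = (\<Sum>i<k. u $ i * (A *\<^sub>v v) $ i)"
    using assms(1) by (simp add: scalar_prod_def atLeast0LessThan)
  then show ?thesis
    using index_mult_mat_vec_sum[OF assms(1,3)] by simp
qed

section \<open>The energy inequality\<close>

lemma symmetric_form_difference:
  fixes A :: "nat \<Rightarrow> nat \<Rightarrow> real"
  assumes "\<And>i j. i < n \<Longrightarrow> j < n \<Longrightarrow> A i j = A j i"
  shows "2 * (\<Sum>i<n. (u i - v i) * (\<Sum>j<n. A i j * u j)) =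
    (\<Sum>i<n. u i * (\<Sum>j<n. A i j * u j)) - (\<Sum>i<n. v i * (\<Sum>j<n. A i j * v j))
    + (\<Sum>i<n. (u i - v i) * (\<Sum>j<n. A i j * (u j - v j)))"
proof -
  have "(\<Sum>i<n. u i * (\<Sum>j<n. A i j * v j)) = (\<Sum>i<n. \<Sum>j<n. u j * (A j i * v i))"
    unfolding sum_distrib_left by (rule sum.swap)
  also have "\<dots> = (\<Sum>i<n. v i * (\<Sum>j<n. A i j * u j))"
    unfolding sum_distrib_left using assms by (intro sum.cong) auto
  finally show ?thesis
    by (simp add: algebra_simps sum.distrib sum_subtractf)
qed

text \<open>The energy estimate in coordinates, free of meshes and blocks. \<open>MO\<close> and
  \<open>MG\<close> are the diagonals of the mass matrices, \<open>u\<close> and \<open>v\<close>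
  the new and old phase field, \<open>p\<close> and \<open>q\<close> the chemical potentials in the
  bulk and on the surface, \<open>f\<close> and \<open>k\<close> the derivatives of the split
  potentials.\<close>

lemma energy_inequality_sums:
  fixes LO LG :: "nat \<Rightarrow> nat \<Rightarrow> real"
  assumes g: "g \<le> n"
    and symO: "\<And>i j. i < n \<Longrightarrow> j < n \<Longrightarrow> LO i j = LO j i"
    and symG: "\<And>i j. i < g \<Longrightarrow> j < g \<Longrightarrow> LG i j = LG j i"
    and posO: "\<And>i. i < n \<Longrightarrow> MO i > 0" and posG: "\<And>i. i < g \<Longrightarrow> MG i > 0"
    and step: "\<And>i. i < n \<Longrightarrow> MO i * (u i - v i) = - (\<tau> * m * (\<Sum>j<n. LO i j * p j))"
    and inner: "\<And>i. g \<le> i \<Longrightarrow> i < n \<Longrightarrow> MO i * p i = (\<Sum>j<n. LO i j * u j) + MO i * f i"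
    and bdry: "\<And>i. i < g \<Longrightarrow> MG i * q i + MO i * p i =
       (\<Sum>j<n. LO i j * u j) + MO i * f i + \<kappa> * (\<Sum>j<g. LG i j * u j) + MG i * k i"
    and flux: "\<And>i. i < g \<Longrightarrow> m * (\<Sum>j<n. LO i j * p j) = m' * (MO i / MG i * (\<Sum>j<g. LG i j * q j))"
    and convF: "\<And>i. i < n \<Longrightarrow> F (u i) - F (v i) \<le> f i * (u i - v i)"
    and convG: "\<And>i. i < g \<Longrightarrow> G (u i) - G (v i) + \<beta> * (u i - v i)\<^sup>2 \<le> k i * (u i - v i)"
  shows "1/2 * (\<Sum>i<n. u i * (\<Sum>j<n. LO i j * u j))
    + 1/2 * (\<Sum>i<n. (u i - v i) * (\<Sum>j<n. LO i j * (u j - v j)))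
    + (\<Sum>i<n. MO i * F (u i))
    + 1/2 * \<kappa> * (\<Sum>i<g. u i * (\<Sum>j<g. LG i j * u j))
    + 1/2 * \<kappa> * (\<Sum>i<g. (u i - v i) * (\<Sum>j<g. LG i j * (u j - v j)))
    + (\<Sum>i<g. MG i * G (u i))
    + \<beta> * (\<Sum>i<g. (u i - v i) * (MG i * (u i - v i)))
    + \<tau> * m * (\<Sum>i<n. p i * (\<Sum>j<n. LO i j * p j))
    + \<tau> * m' * (\<Sum>i<g. q i * (\<Sum>j<g. LG i j * q j))
    \<le> 1/2 * (\<Sum>i<n. v i * (\<Sum>j<n. LO i j * v j)) + (\<Sum>i<n. MO i * F (v i))
    + 1/2 * \<kappa> * (\<Sum>i<g. v i * (\<Sum>j<g. LG i j * v j)) + (\<Sum>i<g. MG i * G (v i))"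
proof -
  define d where "d i = u i - v i" for i
  \<comment> \<open>\<open>r\<close> and \<open>b\<close> extend the boundary terms by zero, so that
    the interior and boundary equations for \<open>p\<close> become the single equation
    \<open>all\<close>.\<close>
  define r where "r i = (if i < g then MG i * q i else 0)" for i
  define b where "b i = (if i < g then \<kappa> * (\<Sum>j<g. LG i j * u j) + MG i * k i else 0)" for i
  have split: "(\<Sum>i<n. if i < g then h i else 0) = (\<Sum>i<g. h i)" for h :: "nat \<Rightarrow> real"
  proof -
    have "{..<n} \<inter> {i. i < g} = {..<g}" using g by auto
    then show ?thesis by (simp add: sum.inter_restrict[symmetric] sum.If_cases)
  qed
  have all: "MO i * p i + r i = (\<Sum>j<n. LO i j * u j) + MO i * f i + b i" if "i < n" for i
    using inner[of i] bdry[of i] that by (auto simp: r_def b_def)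
  \<comment> \<open>The bulk time step tested with \<open>p\<close>; then \<open>all\<close>
    replaces \<open>MO i * p i\<close> by the residual terms.\<close>
  have "\<tau> * m * (\<Sum>i<n. p i * (\<Sum>j<n. LO i j * p j)) = (\<Sum>i<n. - (MO i * p i * d i))"
    unfolding sum_distrib_left[of "\<tau> * m"]
  proof (rule sum.cong)
    fix i assume "i \<in> {..<n}"
    then have "\<tau> * m * (\<Sum>j<n. LO i j * p j) = - (MO i * d i)"
      using step[of i] by (simp add: d_def)
    then have "p i * (\<tau> * m * (\<Sum>j<n. LO i j * p j)) = p i * - (MO i * d i)"
      by simp
    then show "\<tau> * m * (p i * (\<Sum>j<n. LO i j * p j)) = - (MO i * p i * d i)"
      by (simp add: mult_ac)
  qed simp
  also have "\<dots> = (\<Sum>i<n. r i * d i - d i * (\<Sum>j<n. LO i j * u j) - MO i * f i * d i - b i * d i)"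
  proof (rule sum.cong)
    fix i assume "i \<in> {..<n}"
    then have "MO i * p i = (\<Sum>j<n. LO i j * u j) + MO i * f i + b i - r i" using all[of i] by auto
    then have "MO i * p i * d i = ((\<Sum>j<n. LO i j * u j) + MO i * f i + b i - r i) * d i" by simp
    then show "- (MO i * p i * d i) = r i * d i - d i * (\<Sum>j<n. LO i j * u j) - MO i * f i * d i - b i * d i"
      by (simp add: algebra_simps)
  qed simp
  also have "\<dots> = (\<Sum>i<n. if i < g then MG i * q i * d i else 0) - (\<Sum>i<n. d i * (\<Sum>j<n. LO i j * u j))
     - (\<Sum>i<n. MO i * (f i * d i)) - (\<Sum>i<n. if i < g then \<kappa> * (d i * (\<Sum>j<g. LG i j * u j)) + MG i * (k i * d i) else 0)"
    unfolding sum_subtractf[symmetric] by (rule sum.cong) (auto simp: r_def b_def algebra_simps)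
  also have "\<dots> = (\<Sum>i<g. MG i * q i * d i) - (\<Sum>i<n. d i * (\<Sum>j<n. LO i j * u j))
     - (\<Sum>i<n. MO i * (f i * d i)) - \<kappa> * (\<Sum>i<g. d i * (\<Sum>j<g. LG i j * u j)) - (\<Sum>i<g. MG i * (k i * d i))"
    unfolding split by (simp add: sum.distrib sum_distrib_left)
  also have "(\<Sum>i<g. MG i * q i * d i) = - (\<tau> * m' * (\<Sum>i<g. q i * (\<Sum>j<g. LG i j * q j)))"
    unfolding sum_distrib_left[of "\<tau> * m'"] sum_negf[symmetric]
  proof (rule sum.cong)
    fix i assume "i \<in> {..<g}"
    then have i: "i < g" "i < n" using g by auto
    \<comment> \<open>The time step combined with the flux condition. Cancelling
      \<open>MO i\<close>, which is positive, leaves the discrete surface equation, here tested with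
      \<open>q\<close>.\<close>
    have "MO i * d i = - (\<tau> * (m' * (MO i / MG i * (\<Sum>j<g. LG i j * q j))))"
      unfolding d_def step[OF i(2)] flux[OF i(1), symmetric] by simp
    then have "MO i * (MG i * d i) = MO i * - (\<tau> * m' * (\<Sum>j<g. LG i j * q j))"
      using posG[OF i(1)] by (simp add: field_simps)
    then have "MG i * d i = - (\<tau> * m' * (\<Sum>j<g. LG i j * q j))"
      using posO[OF i(2)] unfolding mult_cancel_left by simp
    moreover have "MG i * q i * d i = q i * (MG i * d i)" by (simp add: mult_ac)
    ultimately have "MG i * q i * d i = q i * - (\<tau> * m' * (\<Sum>j<g. LG i j * q j))"
      by (simp only:)
    then show "MG i * q i * d i = - (\<tau> * m' * (q i * (\<Sum>j<g. LG i j * q j)))"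
      by (simp add: mult_ac)
  qed simp
  finally have main: "\<tau> * m * (\<Sum>i<n. p i * (\<Sum>j<n. LO i j * p j)) + \<tau> * m' * (\<Sum>i<g. q i * (\<Sum>j<g. LG i j * q j))
     = - (\<Sum>i<n. d i * (\<Sum>j<n. LO i j * u j))
     - (\<Sum>i<n. MO i * (f i * d i)) - \<kappa> * (\<Sum>i<g. d i * (\<Sum>j<g. LG i j * u j)) - (\<Sum>i<g. MG i * (k i * d i))"
    by simp
  have F: "(\<Sum>i<n. MO i * F (u i)) - (\<Sum>i<n. MO i * F (v i)) \<le> (\<Sum>i<n. MO i * (f i * d i))"
    unfolding sum_subtractf[symmetric] right_diff_distrib[symmetric] d_def
    using convF posO by (intro sum_mono mult_left_mono) (auto intro: less_imp_le)
  have "(\<Sum>i<g. MG i * (G (u i) - G (v i) + \<beta> * (u i - v i)\<^sup>2)) \<le> (\<Sum>i<g. MG i * (k i * d i))"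
    unfolding d_def using convG posG by (intro sum_mono mult_left_mono) (auto intro: less_imp_le)
  then have G: "(\<Sum>i<g. MG i * G (u i)) - (\<Sum>i<g. MG i * G (v i)) + \<beta> * (\<Sum>i<g. d i * (MG i * d i))
      \<le> (\<Sum>i<g. MG i * (k i * d i))"
    by (simp add: d_def algebra_simps sum.distrib sum_subtractf sum_distrib_left power2_eq_square)
  have "2 * (\<Sum>i<g. d i * (\<Sum>j<g. LG i j * u j)) = (\<Sum>i<g. u i * (\<Sum>j<g. LG i j * u j))
     - (\<Sum>i<g. v i * (\<Sum>j<g. LG i j * v j)) + (\<Sum>i<g. d i * (\<Sum>j<g. LG i j * d j))"
    unfolding d_def by (rule symmetric_form_difference) (rule symG)
  \<comment> \<open>Scaled in advance, since the closing step is linear arithmetic in the sums and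
    cannot multiply by the variable \<kappa>.\<close>
  from arg_cong[OF this, of "\<lambda>s. 1/2 * \<kappa> * s"]
  have B: "\<kappa> * (\<Sum>i<g. d i * (\<Sum>j<g. LG i j * u j)) = 1/2 * \<kappa> * (\<Sum>i<g. u i * (\<Sum>j<g. LG i j * u j))
     - 1/2 * \<kappa> * (\<Sum>i<g. v i * (\<Sum>j<g. LG i j * v j)) + 1/2 * \<kappa> * (\<Sum>i<g. d i * (\<Sum>j<g. LG i j * d j))"
    by (simp add: distrib_left right_diff_distrib)
  have A: "2 * (\<Sum>i<n. d i * (\<Sum>j<n. LO i j * u j)) = (\<Sum>i<n. u i * (\<Sum>j<n. LO i j * u j))
     - (\<Sum>i<n. v i * (\<Sum>j<n. LO i j * v j)) + (\<Sum>i<n. d i * (\<Sum>j<n. LO i j * d j))"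
    unfolding d_def by (rule symmetric_form_difference) (rule symO)
  show ?thesis
    using main F G A B unfolding d_def[symmetric] by linarith
qed

text \<open>Tangents lie below a convex and above a concave function. The tangent point is the new
  value \<open>s\<close> for the convex part and the old value \<open>t\<close> for the concave
  part, matching the implicit and explicit terms of the scheme.\<close>

lemma convex_concave_splitting_le:
  assumes "convex_concave_splitting F Fp Fm"
  shows "Fp s - Fp t \<le> deriv Fp s * (s - t)" and "Fm s - Fm t \<le> deriv Fm t * (s - t)"
proof -
  have "(Fp has_field_derivative deriv Fp r) (at r)" "(Fm has_field_derivative deriv Fm r) (at r)" for r
    using assms unfolding convex_concave_splitting_def C1_differentiable_on_eq
    by (auto simp: DERIV_deriv_iff_real_differentiable)
  then have D: "(Fp has_field_derivative deriv Fp s) (at s)"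
    "((\<lambda>r. - Fm r) has_field_derivative - deriv Fm t) (at t)"
    by (auto intro: DERIV_minus)
  have cv: "convex_on UNIV Fp" "convex_on UNIV (\<lambda>r. - Fm r)"
    using assms by (auto simp: convex_concave_splitting_def concave_on_def)
  show "Fp s - Fp t \<le> deriv Fp s * (s - t)"
    using convex_on_imp_above_tangent[OF cv(1), of s t "deriv Fp s"] D(1) by (simp add: algebra_simps)
  show "Fm s - Fm t \<le> deriv Fm t * (s - t)"
    using convex_on_imp_above_tangent[OF cv(2), of t s "- deriv Fm t"] D(2) by (simp add: algebra_simps)
qed

theorem lemma3p3:
  fixes \<Omega> :: "'a::euclidean_space set"
    and \<T> \<T>\<^sub>\<Gamma> :: "real \<Rightarrow> 'a set set"
    and x :: "nat \<Rightarrow> 'a"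
    and \<chi> \<chi>\<^sub>\<Gamma> :: "nat \<Rightarrow> 'a \<Rightarrow> real"
    and F Fp Fm G Gp Gm :: "real \<Rightarrow> real"
    and m m\<^sub>\<Gamma> \<kappa> \<beta> T \<tau> h :: real
    and N n g :: nat
    and M\<^sub>\<Omega> M\<^sub>\<Gamma> L\<^sub>\<Omega> L\<^sub>\<Gamma> S :: "real mat"
    and \<Phi> \<Phi>\<^sub>o\<^sub>l\<^sub>d P P\<^sub>\<Gamma> R\<^sub>\<Gamma> R\<^sub>i ones :: "real vec"
  assumes dim: "DIM('a) \<in> {2, 3}"
    and domain: "convex_polyhedral_domain \<Omega>"
    and params: "m > 0" "m\<^sub>\<Gamma> > 0" "\<kappa> \<ge> 0"
    and T: "T > 0" "N > 0" "\<tau> = T / real N"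
    and S1: "bulk_mesh_family \<Omega> \<T>"
    and S2: "surface_mesh_family \<Omega> \<T> \<T>\<^sub>\<Gamma>"
    and h: "h > 0"
    and P1: "convex_concave_splitting F Fp Fm" "convex_concave_splitting G Gp Gm"
    and P2_decomp: "quartic_plus_lipschitz Fp" "quartic_plus_lipschitz Fm"
                   "quartic_plus_lipschitz Gp" "quartic_plus_lipschitz Gm"
    and P2_beta: "\<beta> \<ge> 0" "\<kappa> = 0 \<Longrightarrow> \<beta> > 0"
      "\<And>s1 s2. deriv Gm s2 * (s1 - s2) \<ge> Gm s1 - Gm s2 + \<beta> * \<bar>s1 - s2\<bar>\<^sup>2"
    and n: "n = card (mesh_vertices (\<T> h))"
    and g: "g = card (mesh_vertices (\<T>\<^sub>\<Gamma> h))"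
    and vertices: "bij_betw x {..<n} (mesh_vertices (\<T> h))"
    and vertices_\<Gamma>: "bij_betw x {..<g} (mesh_vertices (\<T>\<^sub>\<Gamma> h))"
    and first_vertices: "x ` {..<g} = mesh_vertices (\<T> h) \<inter> frontier \<Omega>"
    and basis: "nodal_basis (closure \<Omega>) (\<T> h) n x \<chi>"
    and basis_\<Gamma>: "nodal_basis (frontier \<Omega>) (\<T>\<^sub>\<Gamma> h) g x \<chi>\<^sub>\<Gamma>"
    and M\<^sub>\<Omega>: "M\<^sub>\<Omega> = bulk_mass \<Omega> n x \<chi>"
    and M\<^sub>\<Gamma>: "M\<^sub>\<Gamma> = surface_mass \<Omega> g x \<chi>\<^sub>\<Gamma>"
    and L\<^sub>\<Omega>: "L\<^sub>\<Omega> = bulk_stiffness \<Omega> n \<chi>"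
    and L\<^sub>\<Gamma>: "L\<^sub>\<Gamma> = surface_stiffness \<Omega> g \<chi>\<^sub>\<Gamma>"
    and \<Phi>: "\<Phi> \<in> carrier_vec n" "\<Phi>\<^sub>o\<^sub>l\<^sub>d \<in> carrier_vec n"
    and R\<^sub>\<Gamma>: "R\<^sub>\<Gamma> = submatrix L\<^sub>\<Omega> {..<g} {..<n} *\<^sub>v \<Phi>
      + submatrix M\<^sub>\<Omega> {..<g} {..<n} *\<^sub>v (map_vec (deriv Fp) \<Phi> + map_vec (deriv Fm) \<Phi>\<^sub>o\<^sub>l\<^sub>d)
      + \<kappa> \<cdot>\<^sub>v (L\<^sub>\<Gamma> *\<^sub>v vec_first \<Phi> g)
      + M\<^sub>\<Gamma> *\<^sub>v (map_vec (deriv Gp) (vec_first \<Phi> g) + map_vec (deriv Gm) (vec_first \<Phi>\<^sub>o\<^sub>l\<^sub>d g))"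
    and R\<^sub>i: "R\<^sub>i = submatrix L\<^sub>\<Omega> {g..<n} {..<n} *\<^sub>v \<Phi>
      + submatrix M\<^sub>\<Omega> {g..<n} {..<n} *\<^sub>v (map_vec (deriv Fp) \<Phi> + map_vec (deriv Fm) \<Phi>\<^sub>o\<^sub>l\<^sub>d)"
    and S: "S = m \<cdot>\<^sub>m submatrix L\<^sub>\<Omega> {..<g} {..<g}
      + m\<^sub>\<Gamma> \<cdot>\<^sub>m (submatrix M\<^sub>\<Omega> {..<g} {..<g} * minv M\<^sub>\<Gamma> * L\<^sub>\<Gamma> * minv M\<^sub>\<Gamma> * submatrix M\<^sub>\<Omega> {..<g} {..<g})"
    and P: "P \<in> carrier_vec n"
    and P_interior: "vec_last P (n - g) = minv (submatrix M\<^sub>\<Omega> {g..<n} {g..<n}) *\<^sub>v R\<^sub>i"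
    and P_boundary: "vec_first P g = minv S *\<^sub>v
      ((- m) \<cdot>\<^sub>v (submatrix L\<^sub>\<Omega> {..<g} {g..<n} *\<^sub>v (minv (submatrix M\<^sub>\<Omega> {g..<n} {g..<n}) *\<^sub>v R\<^sub>i))
       + m\<^sub>\<Gamma> \<cdot>\<^sub>v (submatrix M\<^sub>\<Omega> {..<g} {..<g} *\<^sub>v (minv M\<^sub>\<Gamma> *\<^sub>v (L\<^sub>\<Gamma> *\<^sub>v (minv M\<^sub>\<Gamma> *\<^sub>v R\<^sub>\<Gamma>)))))"
    and P\<^sub>\<Gamma>: "P\<^sub>\<Gamma> = - (minv M\<^sub>\<Gamma> *\<^sub>v (submatrix M\<^sub>\<Omega> {..<g} {..<g} *\<^sub>v vec_first P g)) + minv M\<^sub>\<Gamma> *\<^sub>v R\<^sub>\<Gamma>"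
    and solution: "\<Phi> + (\<tau> * m) \<cdot>\<^sub>v (minv M\<^sub>\<Omega> *\<^sub>v (L\<^sub>\<Omega> *\<^sub>v P)) = \<Phi>\<^sub>o\<^sub>l\<^sub>d"
    and ones: "ones = vec n (\<lambda>_. 1)"
  shows "1/2 * (\<Phi> \<bullet> (L\<^sub>\<Omega> *\<^sub>v \<Phi>))
      + 1/2 * ((\<Phi> - \<Phi>\<^sub>o\<^sub>l\<^sub>d) \<bullet> (L\<^sub>\<Omega> *\<^sub>v (\<Phi> - \<Phi>\<^sub>o\<^sub>l\<^sub>d)))
      + ones \<bullet> (M\<^sub>\<Omega> *\<^sub>v map_vec F \<Phi>)
      + 1/2 * \<kappa> * (vec_first \<Phi> g \<bullet> (L\<^sub>\<Gamma> *\<^sub>v vec_first \<Phi> g))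
      + 1/2 * \<kappa> * (vec_first (\<Phi> - \<Phi>\<^sub>o\<^sub>l\<^sub>d) g \<bullet> (L\<^sub>\<Gamma> *\<^sub>v vec_first (\<Phi> - \<Phi>\<^sub>o\<^sub>l\<^sub>d) g))
      + vec_first ones g \<bullet> (M\<^sub>\<Gamma> *\<^sub>v map_vec G (vec_first \<Phi> g))
      + \<beta> * (vec_first (\<Phi> - \<Phi>\<^sub>o\<^sub>l\<^sub>d) g \<bullet> (M\<^sub>\<Gamma> *\<^sub>v vec_first (\<Phi> - \<Phi>\<^sub>o\<^sub>l\<^sub>d) g))
      + \<tau> * m * (P \<bullet> (L\<^sub>\<Omega> *\<^sub>v P))
      + \<tau> * m\<^sub>\<Gamma> * (P\<^sub>\<Gamma> \<bullet> (L\<^sub>\<Gamma> *\<^sub>v P\<^sub>\<Gamma>))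
    \<le> 1/2 * (\<Phi>\<^sub>o\<^sub>l\<^sub>d \<bullet> (L\<^sub>\<Omega> *\<^sub>v \<Phi>\<^sub>o\<^sub>l\<^sub>d))
      + ones \<bullet> (M\<^sub>\<Omega> *\<^sub>v map_vec F \<Phi>\<^sub>o\<^sub>l\<^sub>d)
      + 1/2 * \<kappa> * (vec_first \<Phi>\<^sub>o\<^sub>l\<^sub>d g \<bullet> (L\<^sub>\<Gamma> *\<^sub>v vec_first \<Phi>\<^sub>o\<^sub>l\<^sub>d g))
      + vec_first ones g \<bullet> (M\<^sub>\<Gamma> *\<^sub>v map_vec G (vec_first \<Phi>\<^sub>o\<^sub>l\<^sub>d g))"
proof -

  \<comment> \<open>Mesh data, diagonal mass matrices and their blocks\<close>
  have part: "simplicial_partition (int DIM('a)) (closure \<Omega>) (\<T> h)"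
    using S1 h by (auto simp: bulk_mesh_family_def)
  have part': "simplicial_partition (int DIM('a) - 1) (frontier \<Omega>) (\<T>\<^sub>\<Gamma> h)"
    using S2 h by (auto simp: surface_mesh_family_def)
  have match: "\<forall>K'\<in>\<T>\<^sub>\<Gamma> h. \<exists>K\<in>\<T> h. closure K' = closure K \<inter> frontier \<Omega>"
    using S2 h unfolding surface_mesh_family_def by blast
  have vert: "x ` {..<n} = mesh_vertices (\<T> h)" and vert': "x ` {..<g} = mesh_vertices (\<T>\<^sub>\<Gamma> h)"
    using vertices vertices_\<Gamma> by (auto simp: bij_betw_def)
  have gn: "g \<le> n"
  proof -
    have "x ` {..<g} \<subseteq> x ` {..<n}"
      unfolding first_vertices vert by blast
    then have "card (x ` {..<g}) \<le> card (x ` {..<n})"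
      by (intro card_mono) auto
    then show ?thesis
      unfolding card_image[OF bij_betw_imp_inj_on[OF vertices]]
        card_image[OF bij_betw_imp_inj_on[OF vertices_\<Gamma>]] by simp
  qed
  have car: "M\<^sub>\<Omega> \<in> carrier_mat n n" "L\<^sub>\<Omega> \<in> carrier_mat n n" "M\<^sub>\<Gamma> \<in> carrier_mat g g" "L\<^sub>\<Gamma> \<in> carrier_mat g g"
    unfolding M\<^sub>\<Omega> L\<^sub>\<Omega> M\<^sub>\<Gamma> L\<^sub>\<Gamma>
    by (simp_all add: bulk_mass_def bulk_stiffness_def surface_mass_def surface_stiffness_def)
  obtain d where d: "\<forall>i<n. 0 < d i" "\<forall>i<n. \<forall>j<n. M\<^sub>\<Omega> $$ (i, j) = (if i = j then d i else 0)"
    unfolding M\<^sub>\<Omega> by (rule bulk_mass_diagonal[OF domain part vert basis])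
  obtain c where c: "\<forall>i<g. 0 < c i" "\<forall>i<g. \<forall>j<g. M\<^sub>\<Gamma> $$ (i, j) = (if i = j then c i else 0)"
    unfolding M\<^sub>\<Gamma> by (rule surface_mass_diagonal[OF domain part' vert' basis_\<Gamma>])
  note mb = submatrix_blocks[OF car(1) gn] and lb = submatrix_blocks[OF car(2) gn]
  let ?Mb = "submatrix M\<^sub>\<Omega> {..<g} {..<g}" and ?Mi = "submatrix M\<^sub>\<Omega> {g..<n} {g..<n}"
  have MO: "(M\<^sub>\<Omega> *\<^sub>v w) $ i = d i * w $ i" if "w \<in> carrier_vec n" "i < n" for w i
    by (rule diagonal_mult_vec[OF car(1) that d(2)])
  have MG: "(M\<^sub>\<Gamma> *\<^sub>v w) $ i = c i * w $ i" if "w \<in> carrier_vec g" "i < g" for w i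
    by (rule diagonal_mult_vec[OF car(3) that c(2)])
  have Mb: "(?Mb *\<^sub>v w) $ i = d i * w $ i" if "w \<in> carrier_vec g" "i < g" for w i
    by (rule diagonal_mult_vec[OF mb(3) that]) (use mb(8) d(2) gn in auto)
  have Mbn: "(submatrix M\<^sub>\<Omega> {..<g} {..<n} *\<^sub>v w) $ i = d i * w $ i" if "w \<in> carrier_vec n" "i < g" for w i
    unfolding MO[OF that(1) less_le_trans[OF that(2) gn], symmetric]
      index_mult_mat_vec_sum[OF mb(1) that] index_mult_mat_vec_sum[OF car(1) that(1) less_le_trans[OF that(2) gn]]
    using that mb(6) by (intro sum.cong) auto
  have Min: "(submatrix M\<^sub>\<Omega> {g..<n} {..<n} *\<^sub>v w) $ i = d (g + i) * w $ (g + i)"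
    if "w \<in> carrier_vec n" "i < n - g" for w i
  proof -
    have "g + i < n" using that by simp
    then show ?thesis
      unfolding MO[OF that(1) \<open>g + i < n\<close>, symmetric]
        index_mult_mat_vec_sum[OF mb(2) that] index_mult_mat_vec_sum[OF car(1) that(1) \<open>g + i < n\<close>]
      using that mb(7) by (intro sum.cong) auto
  qed
  have dmi: "\<forall>i<n - g. \<forall>j<n - g. ?Mi $$ (i, j) = (if i = j then d (g + i) else 0)"
    and pmi: "\<forall>i<n - g. 0 < d (g + i)"
    using mb(10) d by auto
  note mi = diagonal_minv[OF mb(5) dmi pmi]
  note mg = diagonal_minv[OF car(3) c(2,1)]
  note mo = diagonal_minv[OF car(1) d(2,1)]
  have pmg: "\<And>i. i < g \<Longrightarrow> 0 < c i" and pmo: "\<And>i. i < n \<Longrightarrow> 0 < d i" using c d by auto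

  \<comment> \<open>The residuals in coordinates\<close>
  let ?fv = "map_vec (deriv Fp) \<Phi> + map_vec (deriv Fm) \<Phi>\<^sub>o\<^sub>l\<^sub>d"
  let ?kv = "map_vec (deriv Gp) (vec_first \<Phi> g) + map_vec (deriv Gm) (vec_first \<Phi>\<^sub>o\<^sub>l\<^sub>d g)"
  define f where "f i = deriv Fp (\<Phi> $ i) + deriv Fm (\<Phi>\<^sub>o\<^sub>l\<^sub>d $ i)" for i
  define k where "k i = deriv Gp (\<Phi> $ i) + deriv Gm (\<Phi>\<^sub>o\<^sub>l\<^sub>d $ i)" for i
  have fv: "?fv \<in> carrier_vec n" "\<And>i. i < n \<Longrightarrow> ?fv $ i = f i"
    using \<Phi> by (auto simp: f_def)
  have kv: "?kv \<in> carrier_vec g" "\<And>i. i < g \<Longrightarrow> ?kv $ i = k i"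
    by (auto simp: k_def vec_first_def)
  have first: "\<And>i. i < g \<Longrightarrow> vec_first v g $ i = v $ i" for v :: "real vec"
    by (simp add: vec_first_def)
  have RG_car: "R\<^sub>\<Gamma> \<in> carrier_vec g"
    unfolding R\<^sub>\<Gamma> using mb(1) lb(1) car(3,4) \<Phi> fv(1) kv(1) by auto
  have Ri_car: "R\<^sub>i \<in> carrier_vec (n - g)"
    unfolding R\<^sub>i using mb(2) lb(2) \<Phi> fv(1) by auto
  have RG: "R\<^sub>\<Gamma> $ i = (\<Sum>j<n. L\<^sub>\<Omega> $$ (i, j) * \<Phi> $ j) + d i * f i
      + \<kappa> * (\<Sum>j<g. L\<^sub>\<Gamma> $$ (i, j) * \<Phi> $ j) + c i * k i" if i: "i < g" for i
  proof -
    have "(submatrix L\<^sub>\<Omega> {..<g} {..<n} *\<^sub>v \<Phi>) $ i = (\<Sum>j<n. L\<^sub>\<Omega> $$ (i, j) * \<Phi> $ j)"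
      unfolding index_mult_mat_vec_sum[OF lb(1) \<Phi>(1) i] using lb(6) i by (intro sum.cong) auto
    moreover have "(L\<^sub>\<Gamma> *\<^sub>v vec_first \<Phi> g) $ i = (\<Sum>j<g. L\<^sub>\<Gamma> $$ (i, j) * \<Phi> $ j)"
      unfolding index_mult_mat_vec_sum[OF car(4) vec_first_carrier i] by (intro sum.cong) (auto simp: first)
    moreover have "dim_row L\<^sub>\<Gamma> = g" "dim_row M\<^sub>\<Gamma> = g" "dim_row (submatrix M\<^sub>\<Omega> {..<g} {..<n}) = g"
      "dim_row (submatrix L\<^sub>\<Omega> {..<g} {..<n}) = g"
      using car mb(1) lb(1) by auto
    ultimately show ?thesis
      unfolding R\<^sub>\<Gamma> using i Mbn[OF fv(1) i] MG[OF kv(1) i] fv(2)[OF less_le_trans[OF i gn]] kv(2)[OF i]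
      by (simp del: index_mult_mat_vec)
  qed
  have Ri: "R\<^sub>i $ i = (\<Sum>j<n. L\<^sub>\<Omega> $$ (g + i, j) * \<Phi> $ j) + d (g + i) * f (g + i)" if i: "i < n - g" for i
  proof -
    have "(submatrix L\<^sub>\<Omega> {g..<n} {..<n} *\<^sub>v \<Phi>) $ i = (\<Sum>j<n. L\<^sub>\<Omega> $$ (g + i, j) * \<Phi> $ j)"
      unfolding index_mult_mat_vec_sum[OF lb(2) \<Phi>(1) i] using lb(7) i by (intro sum.cong) auto
    moreover have "dim_row (submatrix M\<^sub>\<Omega> {g..<n} {..<n}) = n - g"
      "dim_row (submatrix L\<^sub>\<Omega> {g..<n} {..<n}) = n - g"
      using mb(2) lb(2) by auto
    ultimately show ?thesis
      unfolding R\<^sub>i using i Min[OF fv(1) i] fv(2)[of "g + i"] by (simp del: index_mult_mat_vec)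
  qed

  \<comment> \<open>Equations for the chemical potentials\<close>
  let ?P = "vec_first P g" and ?Q = "minv ?Mi *\<^sub>v R\<^sub>i"
  have Q_car: "?Q \<in> carrier_vec (n - g)"
    using mi(1) Ri_car by (rule mult_mat_vec_carrier)
  \<comment> \<open>\<open>P\<close> has dimension \<open>n\<close>, so its last
    \<open>n - g\<close> entries start at index \<open>g\<close>.\<close>
  have Q: "?Q $ i = P $ (g + i)" if "i < n - g" for i
    using arg_cong[OF P_interior, of "\<lambda>v. v $ i"] that P gn by (simp add: vec_last_def)
  have interior_eq: "d i * P $ i = (\<Sum>j<n. L\<^sub>\<Omega> $$ (i, j) * \<Phi> $ j) + d i * f i" if "g \<le> i" "i < n" for i
  proof -
    have i: "i - g < n - g" using that by simp
    have "P $ i = R\<^sub>i $ (i - g) / d i"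
      using Q[OF i] mi(2)[OF Ri_car i] that by simp
    then show ?thesis
      using Ri[OF i] that pmo[OF that(2)] by simp
  qed
  have PG_car: "P\<^sub>\<Gamma> \<in> carrier_vec g"
    unfolding P\<^sub>\<Gamma> using mg(1) mb(3) RG_car by auto
  have PG: "P\<^sub>\<Gamma> $ i = R\<^sub>\<Gamma> $ i / c i - d i * P $ i / c i" if i: "i < g" for i
  proof -
    have "(minv M\<^sub>\<Gamma> *\<^sub>v (?Mb *\<^sub>v ?P)) $ i = d i * P $ i / c i"
      using mg(2)[OF mult_mat_vec_carrier[OF mb(3) vec_first_carrier] i] Mb[OF vec_first_carrier i] first[OF i]
      by simp
    moreover have "dim_row (minv M\<^sub>\<Gamma>) = g" using mg(1) by auto
    ultimately show ?thesis
      unfolding P\<^sub>\<Gamma> using i mg(2)[OF RG_car i] by (simp del: index_mult_mat_vec)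
  qed
  \<comment> \<open>Multiplying the definition of \<open>P\<^sub>\<Gamma>\<close> by the surface
    mass removes both inverses.\<close>
  have boundary_eq: "c i * P\<^sub>\<Gamma> $ i + d i * P $ i = (\<Sum>j<n. L\<^sub>\<Omega> $$ (i, j) * \<Phi> $ j) + d i * f i
      + \<kappa> * (\<Sum>j<g. L\<^sub>\<Gamma> $$ (i, j) * \<Phi> $ j) + c i * k i" if i: "i < g" for i
    using PG[OF i] RG[OF i] pmg[OF i] by (simp add: right_diff_distrib)

  \<comment> \<open>Invertibility of the boundary matrix and the flux identity\<close>
  have LG_dual: "(?Mb *\<^sub>v (minv M\<^sub>\<Gamma> *\<^sub>v (L\<^sub>\<Gamma> *\<^sub>v (minv M\<^sub>\<Gamma> *\<^sub>v w)))) $ i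
      = d i / c i * (\<Sum>j<g. L\<^sub>\<Gamma> $$ (i, j) * (w $ j / c j))" if w: "w \<in> carrier_vec g" and i: "i < g" for w i
  proof -
    note w1 = mult_mat_vec_carrier[OF mg(1) w]
    note w2 = mult_mat_vec_carrier[OF car(4) w1]
    show ?thesis
      unfolding Mb[OF mult_mat_vec_carrier[OF mg(1) w2] i] mg(2)[OF w2 i] index_mult_mat_vec_sum[OF car(4) w1 i]
      using mg(2)[OF w] by simp
  qed
  have S_car: "S \<in> carrier_mat g g"
    unfolding S using lb(3) mb(3) mg(1) car(4) by auto
  have S_vec: "(S *\<^sub>v v) $ i = m * (\<Sum>j<g. L\<^sub>\<Omega> $$ (i, j) * v $ j)
      + m\<^sub>\<Gamma> * (d i / c i * (\<Sum>j<g. L\<^sub>\<Gamma> $$ (i, j) * (d j * v $ j / c j)))"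
    if v: "v \<in> carrier_vec g" and i: "i < g" for v i
  proof -
    have "(submatrix L\<^sub>\<Omega> {..<g} {..<g} *\<^sub>v v) $ i = (\<Sum>j<g. L\<^sub>\<Omega> $$ (i, j) * v $ j)"
      unfolding index_mult_mat_vec_sum[OF lb(3) v i] using lb(8) i by (intro sum.cong) auto
    moreover have "dim_row ?Mb = g" "dim_row (submatrix L\<^sub>\<Omega> {..<g} {..<g}) = g" using mb(3) lb(3) by auto
    ultimately show ?thesis
      unfolding S boundary_matrix_mult_vec[OF lb(3) mb(3) mg(1) car(4) v]
      using i LG_dual[OF mult_mat_vec_carrier[OF mb(3) v] i] Mb[OF v]
      by (simp del: index_mult_mat_vec)
  qed
  have S_ker: "v = 0\<^sub>v g" if v: "v \<in> carrier_vec g" "S *\<^sub>v v = 0\<^sub>v g" for v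
  proof -
    \<comment> \<open>Testing \<open>S *\<^sub>v v\<close> with \<open>v\<close> splits into a bulk
      form in \<open>v\<close> and a surface form in \<open>w\<close>, the vector obtained from
      \<open>v\<close> by the boundary block of the bulk mass and the inverse surface mass. Both are
      nonnegative, and the bulk form vanishes only for \<open>v = 0\<close>.\<close>
    define w where "w j = d j * v $ j / c j" for j
    let ?a = "\<Sum>i<g. v $ i * (\<Sum>j<g. L\<^sub>\<Omega> $$ (i, j) * v $ j)"
      and ?b = "\<Sum>i<g. w i * (\<Sum>j<g. L\<^sub>\<Gamma> $$ (i, j) * w j)"
    have "0 = (\<Sum>i<g. v $ i * (S *\<^sub>v v) $ i)" using v(2) by simp
    also have "\<dots> = m * ?a + m\<^sub>\<Gamma> * ?b"
      unfolding sum_distrib_left[of m] sum_distrib_left[of m\<^sub>\<Gamma>] sum.distrib[symmetric]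
    proof (rule sum.cong)
      fix i assume "i \<in> {..<g}"
      then show "v $ i * (S *\<^sub>v v) $ i = m * (v $ i * (\<Sum>j<g. L\<^sub>\<Omega> $$ (i, j) * v $ j))
          + m\<^sub>\<Gamma> * (w i * (\<Sum>j<g. L\<^sub>\<Gamma> $$ (i, j) * w j))"
        using S_vec[OF v(1), of i] by (simp add: w_def distrib_left mult_ac)
    qed simp
    finally have "m * ?a + m\<^sub>\<Gamma> * ?b = 0" by simp
    moreover have "0 \<le> ?b"
      unfolding L\<^sub>\<Gamma> by (rule surface_stiffness_nonneg[OF domain part' basis_\<Gamma>])
    moreover have "0 \<le> ?a"
      unfolding L\<^sub>\<Omega> by (rule bulk_stiffness_boundary_block(1)[OF domain part part' match vert vert' gn basis])
    ultimately have "m * ?a = 0"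
      using params by (simp add: add_nonneg_eq_0_iff)
    then have "?a = 0" using params by simp
    then have "v $ i = 0" if "i < g" for i
      using bulk_stiffness_boundary_block(2)[OF domain part part' match vert vert' gn basis, of "\<lambda>i. v $ i" i] that
      unfolding L\<^sub>\<Omega> by blast
    then show ?thesis using v(1) by (intro eq_vecI) auto
  qed
  let ?rhs = "(- m) \<cdot>\<^sub>v (submatrix L\<^sub>\<Omega> {..<g} {g..<n} *\<^sub>v ?Q)
     + m\<^sub>\<Gamma> \<cdot>\<^sub>v (?Mb *\<^sub>v (minv M\<^sub>\<Gamma> *\<^sub>v (L\<^sub>\<Gamma> *\<^sub>v (minv M\<^sub>\<Gamma> *\<^sub>v R\<^sub>\<Gamma>))))"
  have rhs_car: "?rhs \<in> carrier_vec g"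
    \<comment> \<open>The dimension of a vector sum is that of its second summand, here the number
      of rows of \<open>?Mb\<close>.\<close>
    by (rule carrier_vecI) (use mb(3) in simp)
  have SP: "S *\<^sub>v ?P = ?rhs"
    unfolding P_boundary by (rule minv_mult_vec(2)[OF S_car rhs_car S_ker])
  \<comment> \<open>Row \<open>i\<close> of \<open>SP\<close>, rearranged: the boundary and interior
    columns of the bulk stiffness combine to a full row applied to \<open>P\<close>, and the two
    surface terms combine to \<open>P\<^sub>\<Gamma>\<close> by \<open>PG\<close>.\<close>
  have flux: "m * (\<Sum>j<n. L\<^sub>\<Omega> $$ (i, j) * P $ j)
      = m\<^sub>\<Gamma> * (d i / c i * (\<Sum>j<g. L\<^sub>\<Gamma> $$ (i, j) * P\<^sub>\<Gamma> $ j))" if i: "i < g" for i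
  proof -
    have "(submatrix L\<^sub>\<Omega> {..<g} {g..<n} *\<^sub>v ?Q) $ i = (\<Sum>j<n - g. L\<^sub>\<Omega> $$ (i, g + j) * P $ (g + j))"
      unfolding index_mult_mat_vec_sum[OF lb(4) Q_car i] using lb(9) i Q by (intro sum.cong) auto
    moreover have "dim_row ?Mb = g" "dim_row (submatrix L\<^sub>\<Omega> {..<g} {g..<n}) = g" using mb(3) lb(4) by auto
    ultimately have rhs: "?rhs $ i = - m * (\<Sum>j<n - g. L\<^sub>\<Omega> $$ (i, g + j) * P $ (g + j))
       + m\<^sub>\<Gamma> * (d i / c i * (\<Sum>j<g. L\<^sub>\<Gamma> $$ (i, j) * (R\<^sub>\<Gamma> $ j / c j)))"
      using i LG_dual[OF RG_car i] by (simp del: index_mult_mat_vec)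
    have lhs: "(S *\<^sub>v ?P) $ i = m * (\<Sum>j<g. L\<^sub>\<Omega> $$ (i, j) * P $ j)
      + m\<^sub>\<Gamma> * (d i / c i * (\<Sum>j<g. L\<^sub>\<Gamma> $$ (i, j) * (d j * P $ j / c j)))"
      using S_vec[OF vec_first_carrier i] first by simp
    have split: "(\<Sum>j<n. L\<^sub>\<Omega> $$ (i, j) * P $ j)
      = (\<Sum>j<g. L\<^sub>\<Omega> $$ (i, j) * P $ j) + (\<Sum>j<n - g. L\<^sub>\<Omega> $$ (i, g + j) * P $ (g + j))"
    proof -
      have "{..<n} = {..<g + (n - g)}" using gn by simp
      then show ?thesis by (simp only: sum_lessThan_add)
    qed
    have diff: "(\<Sum>j<g. L\<^sub>\<Gamma> $$ (i, j) * P\<^sub>\<Gamma> $ j)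
      = (\<Sum>j<g. L\<^sub>\<Gamma> $$ (i, j) * (R\<^sub>\<Gamma> $ j / c j)) - (\<Sum>j<g. L\<^sub>\<Gamma> $$ (i, j) * (d j * P $ j / c j))"
      unfolding sum_subtractf[symmetric] using PG by (intro sum.cong) (auto simp: right_diff_distrib)
    show ?thesis
      using lhs unfolding SP rhs split diff by (simp only: right_diff_distrib distrib_left)
  qed

  \<comment> \<open>The time step and the tangent inequalities in coordinates\<close>
  have step: "d i * (\<Phi> $ i - \<Phi>\<^sub>o\<^sub>l\<^sub>d $ i) = - (\<tau> * m * (\<Sum>j<n. L\<^sub>\<Omega> $$ (i, j) * P $ j))" if i: "i < n" for i
  proof -
    note LP = mult_mat_vec_carrier[OF car(2) P]
    have "dim_row (minv M\<^sub>\<Omega>) = n" using mo(1) by auto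
    then have "\<Phi>\<^sub>o\<^sub>l\<^sub>d $ i = \<Phi> $ i + \<tau> * m * ((L\<^sub>\<Omega> *\<^sub>v P) $ i / d i)"
      unfolding solution[symmetric] using i mo(2)[OF LP i] \<Phi>(1) by (simp del: index_mult_mat_vec)
    then show ?thesis
      using pmo[OF i] unfolding index_mult_mat_vec_sum[OF car(2) P i] by (simp add: field_simps)
  qed
  have F: "F (\<Phi> $ i) - F (\<Phi>\<^sub>o\<^sub>l\<^sub>d $ i) \<le> f i * (\<Phi> $ i - \<Phi>\<^sub>o\<^sub>l\<^sub>d $ i)" for i
    using convex_concave_splitting_le(1)[OF P1(1), of "\<Phi> $ i" "\<Phi>\<^sub>o\<^sub>l\<^sub>d $ i"]
      convex_concave_splitting_le(2)[OF P1(1), of "\<Phi> $ i" "\<Phi>\<^sub>o\<^sub>l\<^sub>d $ i"] P1(1)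
    by (simp add: f_def convex_concave_splitting_def distrib_right)
  \<comment> \<open>For the concave part the strengthened inequality (P2) takes the place of the
    tangent inequality and supplies the quadratic term with \<beta>.\<close>
  have G: "G (\<Phi> $ i) - G (\<Phi>\<^sub>o\<^sub>l\<^sub>d $ i) + \<beta> * (\<Phi> $ i - \<Phi>\<^sub>o\<^sub>l\<^sub>d $ i)\<^sup>2 \<le> k i * (\<Phi> $ i - \<Phi>\<^sub>o\<^sub>l\<^sub>d $ i)" for i
    using convex_concave_splitting_le(1)[OF P1(2), of "\<Phi> $ i" "\<Phi>\<^sub>o\<^sub>l\<^sub>d $ i"]
      P2_beta(3)[where ?s1.0 = "\<Phi> $ i" and ?s2.0 = "\<Phi>\<^sub>o\<^sub>l\<^sub>d $ i"] P1(2)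
    by (simp add: k_def convex_concave_splitting_def distrib_right)

  \<comment> \<open>From vectors and matrices to sums\<close>
  have diff: "\<Phi> - \<Phi>\<^sub>o\<^sub>l\<^sub>d \<in> carrier_vec n" "\<And>i. i < n \<Longrightarrow> (\<Phi> - \<Phi>\<^sub>o\<^sub>l\<^sub>d) $ i = \<Phi> $ i - \<Phi>\<^sub>o\<^sub>l\<^sub>d $ i"
    using \<Phi> by auto
  have formO: "v \<bullet> (L\<^sub>\<Omega> *\<^sub>v v) = (\<Sum>i<n. v $ i * (\<Sum>j<n. L\<^sub>\<Omega> $$ (i, j) * v $ j))"
    if "v \<in> carrier_vec n" for v
    by (rule scalar_prod_mult_mat_vec_sum[OF car(2) that that])
  have formG: "w \<bullet> (L\<^sub>\<Gamma> *\<^sub>v w) = (\<Sum>i<g. w $ i * (\<Sum>j<g. L\<^sub>\<Gamma> $$ (i, j) * w $ j))"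
    if "w \<in> carrier_vec g" for w
    by (rule scalar_prod_mult_mat_vec_sum[OF car(4) that that])
  have massO: "ones \<bullet> (M\<^sub>\<Omega> *\<^sub>v map_vec F v) = (\<Sum>i<n. d i * F (v $ i))" if "v \<in> carrier_vec n" for v
    using that car(1) MO[of "map_vec F v"]
    by (auto simp: scalar_prod_def ones atLeast0LessThan simp del: index_mult_mat_vec intro!: sum.cong)
  have massG: "vec_first ones g \<bullet> (M\<^sub>\<Gamma> *\<^sub>v map_vec G (vec_first v g)) = (\<Sum>i<g. c i * G (v $ i))" for v
    using car(3) MG[of "map_vec G (vec_first v g)"] gn
    by (auto simp: scalar_prod_def ones first atLeast0LessThan simp del: index_mult_mat_vec intro!: sum.cong)
  have massG': "vec_first (\<Phi> - \<Phi>\<^sub>o\<^sub>l\<^sub>d) g \<bullet> (M\<^sub>\<Gamma> *\<^sub>v vec_first (\<Phi> - \<Phi>\<^sub>o\<^sub>l\<^sub>d) g)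
      = (\<Sum>i<g. (\<Phi> $ i - \<Phi>\<^sub>o\<^sub>l\<^sub>d $ i) * (c i * (\<Phi> $ i - \<Phi>\<^sub>o\<^sub>l\<^sub>d $ i)))"
    using car(3) MG[of "vec_first (\<Phi> - \<Phi>\<^sub>o\<^sub>l\<^sub>d) g"] gn diff(2)
    by (auto simp: scalar_prod_def first atLeast0LessThan simp del: index_mult_mat_vec intro!: sum.cong)
  have firstsum: "(\<Sum>i<g. vec_first v g $ i * (\<Sum>j<g. L\<^sub>\<Gamma> $$ (i, j) * vec_first v g $ j))
      = (\<Sum>i<g. v $ i * (\<Sum>j<g. L\<^sub>\<Gamma> $$ (i, j) * v $ j))" for v
    by (simp add: first)
  have diffO: "(\<Sum>i<n. (\<Phi> - \<Phi>\<^sub>o\<^sub>l\<^sub>d) $ i * (\<Sum>j<n. L\<^sub>\<Omega> $$ (i, j) * (\<Phi> - \<Phi>\<^sub>o\<^sub>l\<^sub>d) $ j))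
      = (\<Sum>i<n. (\<Phi> $ i - \<Phi>\<^sub>o\<^sub>l\<^sub>d $ i) * (\<Sum>j<n. L\<^sub>\<Omega> $$ (i, j) * (\<Phi> $ j - \<Phi>\<^sub>o\<^sub>l\<^sub>d $ j)))"
    by (intro sum.cong arg_cong2[where f = "(*)"]) (simp_all add: diff(2) del: index_minus_vec)
  have diffG: "(\<Sum>i<g. (\<Phi> - \<Phi>\<^sub>o\<^sub>l\<^sub>d) $ i * (\<Sum>j<g. L\<^sub>\<Gamma> $$ (i, j) * (\<Phi> - \<Phi>\<^sub>o\<^sub>l\<^sub>d) $ j))
      = (\<Sum>i<g. (\<Phi> $ i - \<Phi>\<^sub>o\<^sub>l\<^sub>d $ i) * (\<Sum>j<g. L\<^sub>\<Gamma> $$ (i, j) * (\<Phi> $ j - \<Phi>\<^sub>o\<^sub>l\<^sub>d $ j)))"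
    using gn by (intro sum.cong arg_cong2[where f = "(*)"]) (simp_all add: diff(2) del: index_minus_vec)
  \<comment> \<open>All scalar products are now sums over indices, and the claim is
    \<open>energy_inequality_sums\<close> with \<open>d\<close> and \<open>c\<close> as the mass
    diagonals and the entries of \<open>P\<close> and \<open>P\<^sub>\<Gamma>\<close> as the
    potentials.\<close>
  show ?thesis
    unfolding formO[OF \<Phi>(1)] formO[OF \<Phi>(2)] formO[OF diff(1)] formO[OF P] formG[OF vec_first_carrier]
      formG[OF PG_car] massO[OF \<Phi>(1)] massO[OF \<Phi>(2)] massG massG' firstsum diffO diffG
  proof (rule energy_inequality_sums[OF gn])
    show "L\<^sub>\<Omega> $$ (i, j) = L\<^sub>\<Omega> $$ (j, i)" if "i < n" "j < n" for i j
      unfolding L\<^sub>\<Omega> using that by (rule bulk_stiffness_symmetric)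
    show "L\<^sub>\<Gamma> $$ (i, j) = L\<^sub>\<Gamma> $$ (j, i)" if "i < g" "j < g" for i j
      unfolding L\<^sub>\<Gamma> using that by (rule surface_stiffness_symmetric)
  qed (use pmo pmg step interior_eq boundary_eq flux F G in auto)
qed

end
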